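(* Let $B$ be a finite Blaschke product with $n$ zeros and let $\mathcal{M}$ be a weak*-closed subspace of $H^\infty$ invariant under $T_B$ (i.e. $B\mathcal M\subset\mathcal M$). Then there exist $B$-inner functions $J_1,\ldots,J_r$ ($r\le n$) such that \[\mathcal{M}=J_1H^\infty(B)\oplus\cdots\oplus J_rH^\infty(B),\] where $\oplus$ denotes a direct sum.
   Context: $H^2,H^\infty$ are the classical Hardy spaces on the unit circle. $B(z)=\prod_{i=1}^n\frac{z-a_i}{1-\overline{a_i}z}$ with $a_i$ in the open unit disc (the paper takes $a_1=0$). $H^\infty(B)=\{f\circ B: f\in H^\infty\}$. A function $\varphi\in H^\infty$ is $B$-inner if $\{B^m\varphi: m=0,1,2,\ldots\}$ is an orthonormal set in $H^2$. *)

theory Defs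
  imports "HOL-Analysis.Analysis"
begin

text \<open>Functions on the open unit disc are represented as complex functions that
  vanish identically outside the disc (canonical representatives).\<close>

definition Hinf :: "(complex \<Rightarrow> complex) set" where
  "Hinf = {f. f holomorphic_on ball 0 1 \<and> bounded (f ` ball 0 1)
              \<and> (\<forall>z. z \<notin> ball 0 1 \<longrightarrow> f z = 0)}"

definition blaschke :: "complex list \<Rightarrow> complex \<Rightarrow> complex" where
  "blaschke a z = (\<Prod>i<length a. (z - a!i) / (1 - cnj (a!i) * z))"

definition HinfB :: "(complex \<Rightarrow> complex) \<Rightarrow> (complex \<Rightarrow> complex) set" where
  "HinfB B = {(\<lambda>z. if z \<in> ball 0 1 then f (B z) else 0) | f. f \<in> Hinf}"

definition h2_inner :: "(complex \<Rightarrow> complex) \<Rightarrow> (complex \<Rightarrow> complex) \<Rightarrow> complex" where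
  "h2_inner f g = Lim (at_left 1) (\<lambda>r::real.
      (LINT t:{0..2*pi}|lborel. f (of_real r * cis t) * cnj (g (of_real r * cis t))) / (2 * pi))"

definition B_inner :: "(complex \<Rightarrow> complex) \<Rightarrow> (complex \<Rightarrow> complex) \<Rightarrow> bool" where
  "B_inner B \<phi> \<longleftrightarrow> \<phi> \<in> Hinf \<and>
     (\<forall>m k::nat. h2_inner (\<lambda>z. B z ^ m * \<phi> z) (\<lambda>z. B z ^ k * \<phi> z) = (if m = k then 1 else 0))"

definition L1_circle :: "(real \<Rightarrow> complex) set" where
  "L1_circle = {g. set_integrable lborel {0..2*pi} g}"

text \<open>Duality pairing between H-infinity (through its boundary function) and L^1.\<close>
definition wpair :: "(complex \<Rightarrow> complex) \<Rightarrow> (real \<Rightarrow> complex) \<Rightarrow> complex" where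
  "wpair f g = Lim (at_left 1) (\<lambda>r::real.
      (LINT t:{0..2*pi}|lborel. f (of_real r * cis t) * g t) / (2 * pi))"

text \<open>Closedness in the weak-star topology of H-infinity, i.e. the weakest topology
  making all functionals f -> wpair f g (g in L^1) continuous.\<close>
definition weakstar_closed :: "(complex \<Rightarrow> complex) set \<Rightarrow> bool" where
  "weakstar_closed M \<longleftrightarrow> M \<subseteq> Hinf \<and>
     (\<forall>f\<in>Hinf. (\<forall>G \<epsilon>. finite G \<and> G \<subseteq> L1_circle \<and> \<epsilon> > 0 \<longrightarrow>
                   (\<exists>h\<in>M. \<forall>g\<in>G. cmod (wpair f g - wpair h g) < \<epsilon>)) \<longrightarrow> f \<in> M)"

definition Hinf_subspace :: "(complex \<Rightarrow> complex) set \<Rightarrow> bool" where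
  "Hinf_subspace M \<longleftrightarrow> M \<subseteq> Hinf \<and> (\<lambda>z. 0) \<in> M \<and>
     (\<forall>f\<in>M. \<forall>g\<in>M. (\<lambda>z. f z + g z) \<in> M) \<and> (\<forall>c. \<forall>f\<in>M. (\<lambda>z. c * f z) \<in> M)"

end

theory Submission
  imports Defs "HOL-Complex_Analysis.Complex_Analysis"
begin

text \<open>
  Work in the Hilbert space \<open>H\<^sup>2\<close> of square-summable Taylor coefficients. Multiplication by \<open>B\<close> is
  an isometry \<open>T\<close> there, because \<open>1 - |B z|\<^sup>2 \<le> C (1 - |z|\<^sup>2)\<close>. Let \<open>K\<close> be the closure of \<open>M\<close> in
  \<open>H\<^sup>2\<close> and \<open>W\<close> the orthogonal complement of \<open>T K\<close> in \<open>K\<close>; the Wold decomposition makes an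
  orthonormal basis \<open>J\<^sub>i\<close> of \<open>W\<close> generate \<open>K\<close>. No boundary values are used: everything is read off
  from the resolvent \<open>R w = (1 - cnj w T)\<^sup>-\<^sup>1\<close>, which satisfies
  \<open>(1 - |w|\<^sup>2) <R w f, R w g> = <f, R w g> + <R w f, g> - <f, g>\<close>.

  By this identity the vectors \<open>sqrt (1 - |w|\<^sup>2) R w J\<^sub>i\<close> are orthonormal, and the Szego kernel at \<open>z\<close>
  is an eigenvector of \<open>T\<^sup>*\<close>. With \<open>w = B z\<close>, Bessel's inequality bounds \<open>\<Sum>|J\<^sub>i z|\<^sup>2\<close> by
  \<open>(1 - |B z|\<^sup>2) / (1 - |z|\<^sup>2)\<close>. So the \<open>J\<^sub>i\<close> are bounded, and integrating over circles gives
  \<open>dim W \<le> n\<close>. The coefficients of \<open>f \<in> K\<close> are \<open>F\<^sub>i w = <f, R w J\<^sub>i>\<close>, and they are bounded when \<open>f\<close>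
  is.

  It remains to see that a bounded \<open>j \<in> K\<close> lies in \<open>M\<close>. If \<open>s\<^sub>n \<in> M\<close> tends to \<open>j\<close> in \<open>H\<^sup>2\<close> and
  \<open>h\<^sub>n = s\<^sub>n - j\<close>, then \<open>H\<^sub>n w = 2 <h\<^sub>n, R w h\<^sub>n> - |h\<^sub>n|\<^sup>2\<close> is holomorphic, has nonnegative real part,
  and \<open>|h\<^sub>n z|\<^sup>2 \<le> C Re (H\<^sub>n (B z))\<close>. Hence the functions \<open>s\<^sub>n / (1 + H\<^sub>n \<circ> B)\<close> of \<open>M\<close> are uniformly
  bounded and converge pointwise to \<open>j\<close>. Such convergence is weak-star: for bounded \<open>g\<close> the pairing
  with \<open>g\<close> is an inner product of \<open>H\<^sup>2\<close>, and bounded functions are dense in \<open>L\<^sup>1\<close>.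
\<close>

section \<open>Complex Hilbert spaces\<close>

class complex_inner = real_inner +
  fixes scaleC :: "complex \<Rightarrow> 'a \<Rightarrow> 'a" (infixr "*\<^sub>C" 75)
    and cinner :: "'a \<Rightarrow> 'a \<Rightarrow> complex"
  assumes scaleC_add_right: "c *\<^sub>C (x + y) = c *\<^sub>C x + c *\<^sub>C y"
    and scaleC_add_left: "(c + d) *\<^sub>C x = c *\<^sub>C x + d *\<^sub>C x"
    and scaleC_scaleC: "c *\<^sub>C d *\<^sub>C x = (c * d) *\<^sub>C x"
    and scaleR_scaleC: "r *\<^sub>R x = of_real r *\<^sub>C x"
    and cinner_commute: "cinner x y = cnj (cinner y x)"
    and cinner_add_left: "cinner (x + y) z = cinner x z + cinner y z"
    and cinner_scaleC_left [simp]: "cinner (c *\<^sub>C x) y = c * cinner x y"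
    and inner_eq_Re_cinner: "inner x y = Re (cinner x y)"

class complex_hilbert = complex_inner + banach

interpretation complex_vector: vector_space "scaleC :: complex \<Rightarrow> 'a \<Rightarrow> 'a::complex_inner"
proof
  show "1 *\<^sub>C x = x" for x :: 'a
    using scaleR_scaleC[of 1 x] by simp
qed (simp_all add: scaleC_add_right scaleC_add_left scaleC_scaleC)

abbreviation csubspace :: "'a::complex_inner set \<Rightarrow> bool"
  where "csubspace \<equiv> complex_vector.subspace"

lemma cinner_scaleC_right [simp]: "cinner x (c *\<^sub>C y) = cnj c * cinner x y"
  by (metis cinner_commute cinner_scaleC_left complex_cnj_mult)

lemma cinner_add_right: "cinner x (y + z) = cinner x y + cinner x z"
  by (metis cinner_commute cinner_add_left complex_cnj_add)

lemma cinner_self: "cinner x x = of_real ((norm x)\<^sup>2)"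
  using cinner_commute[of x x]
  by (simp add: complex_eq_iff power2_norm_eq_inner inner_eq_Re_cinner)

lemma cinner_eq_Complex: "cinner x y = Complex (inner x y) (inner x (\<i> *\<^sub>C y))"
  by (simp add: complex_eq_iff inner_eq_Re_cinner)

lemma norm_scaleC [simp]: "norm (c *\<^sub>C x) = cmod c * norm x"
proof -
  have "complex_of_real ((norm (c *\<^sub>C x))\<^sup>2) = (c * cnj c) * of_real ((norm x)\<^sup>2)"
    by (simp only: cinner_self[symmetric] cinner_scaleC_left cinner_scaleC_right mult_ac)
  then have "(norm (c *\<^sub>C x))\<^sup>2 = (cmod c * norm x)\<^sup>2"
    by (simp only: complex_norm_square[symmetric] of_real_mult[symmetric] of_real_eq_iff
        power_mult_distrib)
  then show ?thesis by simp
qed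

lemma cmod_cinner_le: "cmod (cinner x y) \<le> norm x * norm y"
proof (cases "cinner x y = 0")
  case False
  define u where "u = cnj (cinner x y) / cmod (cinner x y)"
  have "cmod u = 1"
    using False by (simp add: u_def norm_divide)
  have "cinner (u *\<^sub>C x) y = of_real (cmod (cinner x y))"
    using False complex_norm_square[of "cinner x y"]
    by (simp add: u_def power2_eq_square mult.commute nonzero_divide_eq_eq)
  then have "cmod (cinner x y) = inner (u *\<^sub>C x) y"
    by (simp add: inner_eq_Re_cinner)
  also have "\<dots> \<le> norm (u *\<^sub>C x) * norm y"
    by (rule norm_cauchy_schwarz)
  finally show ?thesis
    by (simp add: \<open>cmod u = 1\<close>)
qed simp

interpretation cinner: bounded_bilinear "cinner :: 'a::complex_inner \<Rightarrow> 'a \<Rightarrow> complex"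
proof
  show "\<exists>K. \<forall>x y :: 'a. norm (cinner x y) \<le> norm x * norm y * K"
    by (intro exI[of _ 1]) (simp add: cmod_cinner_le)
qed (simp_all add: cinner_add_left cinner_add_right scaleR_scaleC scaleR_conv_of_real)

interpretation scaleC: bounded_bilinear "scaleC :: complex \<Rightarrow> 'a::complex_inner \<Rightarrow> 'a"
proof
  show "\<exists>K. \<forall>c (x :: 'a). norm (c *\<^sub>C x) \<le> norm c * norm x * K"
    by (intro exI[of _ 1]) simp
qed (simp_all add: scaleC_add_left scaleC_add_right scaleR_scaleC scaleC_scaleC
       scaleR_conv_of_real mult.commute)

lemmas tendsto_cinner [tendsto_intros] = cinner.tendsto
lemmas cinner_linear = cinner.add_left cinner.add_right cinner.diff_left cinner.diff_right

lemma csubspace_imp_subspace: "csubspace S \<Longrightarrow> subspace S"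
  by (auto simp: complex_vector.subspace_def subspace_def scaleR_scaleC)

lemma csubspace_closure:
  assumes "csubspace S" shows "csubspace (closure S)"
proof (rule complex_vector.subspaceI)
  show "0 \<in> closure S"
    using complex_vector.subspace_0[OF assms] closure_subset by blast
next
  fix x y assume "x \<in> closure S" "y \<in> closure S"
  then obtain s t where "\<And>n. s n \<in> S" "s \<longlonglongrightarrow> x" "\<And>n. t n \<in> S" "t \<longlonglongrightarrow> y"
    unfolding closure_sequential by blast
  then show "x + y \<in> closure S"
    unfolding closure_sequential using complex_vector.subspace_add[OF assms]
    by (intro exI[of _ "\<lambda>n. s n + t n"]) (auto intro: tendsto_add)
next
  fix c x assume "x \<in> closure S"
  then obtain s where "\<And>n. s n \<in> S" "s \<longlonglongrightarrow> x"
    unfolding closure_sequential by blast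
  then show "c *\<^sub>C x \<in> closure S"
    unfolding closure_sequential using complex_vector.subspace_scale[OF assms]
    by (intro exI[of _ "\<lambda>n. c *\<^sub>C s n"]) (auto intro: scaleC.tendsto)
qed

lemma dist_sq_le_of_convex:
  fixes S :: "'a::real_inner set"
  assumes "convex S" "u \<in> S" "v \<in> S"
  shows "(dist u v)\<^sup>2 \<le> 2 * (dist x u)\<^sup>2 + 2 * (dist x v)\<^sup>2 - 4 * (infdist x S)\<^sup>2"
proof -
  have "midpoint u v \<in> S"
    using convexD[OF assms, of "1/2" "1/2"] by (simp add: midpoint_def scaleR_right_distrib)
  then have "4 * (infdist x S)\<^sup>2 \<le> 4 * (dist x (midpoint u v))\<^sup>2"
    by (intro mult_left_mono power_mono infdist_le infdist_nonneg) auto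
  also have "\<dots> = 2 * (dist x u)\<^sup>2 + 2 * (dist x v)\<^sup>2 - (dist u v)\<^sup>2"
    unfolding dist_norm power2_norm_eq_inner midpoint_def
    by (simp add: inner_simps inner_commute algebra_simps)
  finally show ?thesis by simp
qed

lemma dist_less_of_near_infdist:
  fixes S :: "'a::real_inner set"
  assumes "convex S" "0 < e"
  obtains d where "0 < d" "\<And>u v. u \<in> S \<inter> cball x (infdist x S + d) \<Longrightarrow>
    v \<in> S \<inter> cball x (infdist x S + d) \<Longrightarrow> dist u v < e"
proof -
  define m where "m = infdist x S"
  have "((\<lambda>d. 4 * (m + d)\<^sup>2 - 4 * m\<^sup>2) \<longlongrightarrow> 4 * (m + 0)\<^sup>2 - 4 * m\<^sup>2) (at_right 0)"
    by (intro tendsto_intros)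
  then have "\<forall>\<^sub>F d in at_right 0. 4 * (m + d)\<^sup>2 - 4 * m\<^sup>2 < e\<^sup>2"
    by (rule order_tendstoD) (use \<open>0 < e\<close> in simp)
  with eventually_at_right_less[of 0]
  have "\<forall>\<^sub>F d in at_right 0. 0 < d \<and> 4 * (m + d)\<^sup>2 - 4 * m\<^sup>2 < e\<^sup>2"
    by (rule eventually_conj)
  then obtain d where d: "0 < d" "4 * (m + d)\<^sup>2 - 4 * m\<^sup>2 < e\<^sup>2"
    using eventually_happens'[OF trivial_limit_at_right_real] by blast
  have "dist u v < e" if u: "u \<in> S \<inter> cball x (m + d)" and v: "v \<in> S \<inter> cball x (m + d)" for u v
  proof -
    have "(dist x u)\<^sup>2 \<le> (m + d)\<^sup>2" "(dist x v)\<^sup>2 \<le> (m + d)\<^sup>2"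
      using u v by (auto intro!: power_mono)
    then have "(dist u v)\<^sup>2 < e\<^sup>2"
      using dist_sq_le_of_convex[OF \<open>convex S\<close>, of u v x] u v d(2) by (simp add: m_def)
    then show ?thesis
      using \<open>0 < e\<close> by (meson less_imp_le power2_less_imp_less)
  qed
  with d(1) that show ?thesis
    by (simp add: m_def)
qed

lemma infdist_less_obtains_dist_less:
  assumes "S \<noteq> {}" "infdist x S < d" obtains s where "s \<in> S" "dist x s < d"
  using assms by (auto simp: infdist_notempty cINF_less_iff bdd_belowI2[of _ 0])

lemma nearest_point_exists:
  fixes S :: "'a::{real_inner,complete_space} set"
  assumes "convex S" "closed S" "S \<noteq> {}"
  obtains p where "p \<in> S" "dist x p = infdist x S"
proof -
  define near where "near n = S \<inter> cball x (infdist x S + inverse (real (Suc n)))" for n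
  have "\<exists>p. \<forall>n. p \<in> near n"
  proof (rule decreasing_closed_nest[of near])
    show "closed (near n)" for n
      using \<open>closed S\<close> by (simp add: near_def closed_Int)
    show "near n \<noteq> {}" for n
    proof -
      obtain s where "s \<in> S" "dist x s < infdist x S + inverse (real (Suc n))"
        using infdist_less_obtains_dist_less[OF \<open>S \<noteq> {}\<close>]
        by (metis less_add_same_cancel1 inverse_positive_iff_positive of_nat_0_less_iff zero_less_Suc)
      then show ?thesis
        by (auto simp: near_def)
    qed
    show "near n \<subseteq> near m" if "m \<le> n" for m n
      unfolding near_def using that
      by (intro Int_mono subset_cball add_left_mono le_imp_inverse_le) auto
    show "\<exists>n. \<forall>u\<in>near n. \<forall>v\<in>near n. dist u v < e" if "0 < e" for e
    proof -
      obtain d where "0 < d" and d: "\<And>u v. u \<in> S \<inter> cball x (infdist x S + d) \<Longrightarrow>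
          v \<in> S \<inter> cball x (infdist x S + d) \<Longrightarrow> dist u v < e"
        using dist_less_of_near_infdist[OF \<open>convex S\<close> \<open>0 < e\<close>] by blast
      obtain n where "inverse (real (Suc n)) < d"
        using reals_Archimedean[OF \<open>0 < d\<close>] by blast
      then have "near n \<subseteq> S \<inter> cball x (infdist x S + d)"
        by (auto simp: near_def)
      then show ?thesis
        using d by blast
    qed
  qed blast
  then obtain p where p: "\<And>n. p \<in> near n" by blast
  have "dist x p \<le> infdist x S"
    by (rule tendsto_lowerbound[OF LIMSEQ_inverse_real_of_nat_add])
       (use p in \<open>simp_all add: near_def\<close>)
  moreover have "p \<in> S"
    using p by (simp add: near_def)
  ultimately show ?thesis
    using that infdist_le[of p S x] by force
qed

lemma complex_orthogonal_projection:
  fixes S :: "'a::complex_hilbert set"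
  assumes S: "csubspace S" "closed S"
  obtains p where "p \<in> S" "\<And>s. s \<in> S \<Longrightarrow> cinner (x - p) s = 0"
proof -
  have "convex S"
    by (intro subspace_imp_convex csubspace_imp_subspace S)
  obtain p where p: "p \<in> S" "dist x p = infdist x S"
    using nearest_point_exists[OF \<open>convex S\<close> \<open>closed S\<close>] complex_vector.subspace_0[OF S(1)] by blast
  have nonpos: "inner (x - p) s \<le> 0" if "s \<in> S" for s
    using any_closest_point_dot[OF \<open>convex S\<close> \<open>closed S\<close> p(1), of "p + s" x]
      complex_vector.subspace_add[OF S(1) p(1) that] p(2) infdist_le[of _ S x]
    by simp
  have "inner (x - p) s = 0" if "s \<in> S" for s
    using nonpos[OF that] nonpos[OF complex_vector.subspace_neg[OF S(1) that]] by simp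
  then have "cinner (x - p) s = 0" if "s \<in> S" for s
    using that complex_vector.subspace_scale[OF S(1) that, of \<i>]
    by (simp add: cinner_eq_Complex complex_eq_iff)
  with p(1) that show ?thesis by blast
qed

lemma closed_csubspace_eqI:
  fixes V :: "'a::complex_hilbert set"
  assumes "csubspace V" "closed V" "csubspace K" "V \<subseteq> K"
    and orth: "\<And>x. x \<in> K \<Longrightarrow> (\<And>v. v \<in> V \<Longrightarrow> cinner x v = 0) \<Longrightarrow> x = 0"
  shows "V = K"
proof
  show "K \<subseteq> V"
  proof
    fix x assume "x \<in> K"
    obtain p where p: "p \<in> V" "\<And>v. v \<in> V \<Longrightarrow> cinner (x - p) v = 0"
      using complex_orthogonal_projection[OF assms(1,2)] by blast
    then have "x - p = 0"
      using \<open>x \<in> K\<close> \<open>V \<subseteq> K\<close> by (intro orth complex_vector.subspace_diff[OF assms(3)]) auto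
    with p(1) show "x \<in> V" by simp
  qed
qed fact

lemma uniform_limit_of_dist_le:
  assumes "\<And>n x. x \<in> S \<Longrightarrow> dist (f n x) (h x) \<le> e n" "(e \<longlongrightarrow> 0) F"
  shows "uniform_limit S f h F"
proof (rule uniform_limitI)
  fix d :: real assume "d > 0"
  with assms(2) have "\<forall>\<^sub>F n in F. e n < d"
    by (rule order_tendstoD)
  then show "\<forall>\<^sub>F n in F. \<forall>x\<in>S. dist (f n x) (h x) < d"
    by eventually_elim (use assms(1) in \<open>auto intro: le_less_trans\<close>)
qed

lemma tendsto_cinner_of_total:
  fixes x :: "'b \<Rightarrow> 'a::complex_hilbert"
  assumes bounded: "\<And>n. norm (x n) \<le> C"
    and total: "\<And>y. (\<And>s. s \<in> S \<Longrightarrow> cinner y s = 0) \<Longrightarrow> y = 0"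
    and lim: "\<And>s. s \<in> S \<Longrightarrow> ((\<lambda>n. cinner (x n) s) \<longlongrightarrow> cinner l s) F"
  shows "((\<lambda>n. cinner (x n) y) \<longlongrightarrow> cinner l y) F"
proof -
  define V where "V = {y. ((\<lambda>n. cinner (x n) y) \<longlongrightarrow> cinner l y) F}"
  have "V = UNIV"
  proof (rule closed_csubspace_eqI)
    show "csubspace V"
      by (rule complex_vector.subspaceI)
         (auto simp: V_def cinner_linear cinner.zero_right intro!: tendsto_add tendsto_mult_left)
    show "closed V"
      unfolding closed_sequential_limits
    proof (intro allI impI, elim conjE)
      fix y s assume s: "\<forall>k. s k \<in> V" "s \<longlonglongrightarrow> y"
      have uniform:
        "uniform_limit UNIV (\<lambda>k n. cinner (x n) (s k)) (\<lambda>n. cinner (x n) y) sequentially"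
      proof (rule uniform_limit_of_dist_le)
        have "(\<lambda>k. C * norm (s k - y)) \<longlonglongrightarrow> C * norm (y - y)"
          by (intro tendsto_intros s(2))
        then show "(\<lambda>k. C * norm (s k - y)) \<longlonglongrightarrow> 0" by simp
        show "dist (cinner (x n) (s k)) (cinner (x n) y) \<le> C * norm (s k - y)" for n k
          unfolding dist_norm cinner.diff_right[symmetric]
          by (rule order_trans[OF cmod_cinner_le mult_right_mono[OF bounded]]) simp
      qed
      show "y \<in> V"
        unfolding V_def mem_Collect_eq using s
        by (intro swap_uniform_limit'[OF _ _ uniform, of "\<lambda>k. cinner l (s k)"])
           (auto simp: V_def intro!: tendsto_intros)
    qed
    show "z = 0" if "\<And>v. v \<in> V \<Longrightarrow> cinner z v = 0" for z
      using that lim by (intro total) (simp add: V_def)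
  qed auto
  then show ?thesis by (auto simp: V_def)
qed

definition orthonormal_on :: "'i set \<Rightarrow> ('i \<Rightarrow> 'a::complex_inner) \<Rightarrow> bool" where
  "orthonormal_on I e \<longleftrightarrow> (\<forall>i\<in>I. \<forall>j\<in>I. cinner (e i) (e j) = (if i = j then 1 else 0))"

lemma orthonormal_onD:
  "orthonormal_on I e \<Longrightarrow> i \<in> I \<Longrightarrow> j \<in> I \<Longrightarrow> cinner (e i) (e j) = (if i = j then 1 else 0)"
  by (simp add: orthonormal_on_def)

lemma norm_orthonormal: "orthonormal_on I e \<Longrightarrow> i \<in> I \<Longrightarrow> norm (e i) = 1"
proof -
  assume "orthonormal_on I e" "i \<in> I"
  then have "complex_of_real ((norm (e i))\<^sup>2) = of_real 1"
    using orthonormal_onD[of I e i i] by (simp add: cinner_self)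
  then show "norm (e i) = 1"
    by (simp only: of_real_eq_iff abs_square_eq_1 abs_norm_cancel)
qed

lemma Bessel_inequality:
  assumes e: "orthonormal_on I e" and "finite I"
  shows "(\<Sum>i\<in>I. (cmod (cinner x (e i)))\<^sup>2) \<le> (norm x)\<^sup>2"
proof -
  define y where "y = (\<Sum>i\<in>I. cinner x (e i) *\<^sub>C e i)"
  have "cinner (x - y) (e j) = 0" if "j \<in> I" for j
  proof -
    have "cinner y (e j) = (\<Sum>i\<in>I. if i = j then cinner x (e i) else 0)"
      unfolding y_def cinner.sum_left
      by (intro sum.cong) (simp_all add: orthonormal_onD[OF e _ that])
    then show ?thesis
      using that \<open>finite I\<close> by (simp add: cinner.diff_left)
  qed
  then have orth: "cinner (x - y) y = 0"
    by (simp add: y_def cinner.sum_right)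
  have "cinner x y = (\<Sum>i\<in>I. of_real ((cmod (cinner x (e i)))\<^sup>2))"
    by (simp add: y_def cinner.sum_right complex_norm_square mult.commute del: of_real_power)
  then have "(\<Sum>i\<in>I. (cmod (cinner x (e i)))\<^sup>2) = Re (cinner x y)"
    by simp
  also have "\<dots> = Re (cinner y y)"
    using orth by (simp add: cinner.diff_left)
  also have "\<dots> \<le> Re (cinner (x - y) (x - y)) + Re (cinner y y)"
    by (simp add: cinner_self)
  also have "\<dots> = (norm x)\<^sup>2"
    using orth cinner_commute[of y "x - y"] cinner_self[of x]
    by (simp add: cinner_linear algebra_simps)
  finally show ?thesis .
qed

definition orthonormal_basis :: "'a::complex_inner set \<Rightarrow> nat \<Rightarrow> (nat \<Rightarrow> 'a) \<Rightarrow> bool" where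
  "orthonormal_basis V r e \<longleftrightarrow> orthonormal_on {..<r} e \<and> e ` {..<r} \<subseteq> V \<and>
     (\<forall>v\<in>V. (\<forall>i<r. cinner v (e i) = 0) \<longrightarrow> v = 0)"

lemma orthonormal_on_Suc:
  assumes e: "orthonormal_on {..<r} e" and v: "v \<noteq> 0" "\<And>i. i < r \<Longrightarrow> cinner v (e i) = 0"
  shows "orthonormal_on {..<Suc r} (e(r := of_real (1 / norm v) *\<^sub>C v))"
proof -
  define u where "u = of_real (1 / norm v) *\<^sub>C v"
  have "cinner u u = 1"
    using v(1) by (simp add: cinner_self u_def norm_divide)
  moreover have "cinner u (e i) = 0" "cinner (e i) u = 0" if "i < r" for i
    using v(2)[OF that] cinner_commute[of "e i" v] by (simp_all add: u_def)
  ultimately show ?thesis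
    unfolding u_def[symmetric] using e by (auto simp: orthonormal_on_def less_Suc_eq)
qed

lemma orthonormal_basis_exists:
  fixes V :: "'a::complex_inner set"
  assumes "csubspace V"
    and bound: "\<And>r e. orthonormal_on {..<r} e \<Longrightarrow> e ` {..<r} \<subseteq> V \<Longrightarrow> r \<le> n"
  obtains r e where "r \<le> n" "orthonormal_basis V r e"
proof -
  define P where "P r \<longleftrightarrow> (\<exists>e :: nat \<Rightarrow> 'a. orthonormal_on {..<r} e \<and> e ` {..<r} \<subseteq> V)" for r
  define r where "r = Greatest P"
  have length_le: "k \<le> n" if "P k" for k
    using that bound by (auto simp: P_def)
  have "P 0"
    by (simp add: P_def orthonormal_on_def)
  then have "P r"
    unfolding r_def by (rule GreatestI_nat) (rule length_le)
  then obtain e where e: "orthonormal_on {..<r} e" "e ` {..<r} \<subseteq> V"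
    by (auto simp: P_def)
  have "v = 0" if v: "v \<in> V" "\<forall>i<r. cinner v (e i) = 0" for v
  proof (rule ccontr)
    assume "v \<noteq> 0"
    then have "orthonormal_on {..<Suc r} (e(r := of_real (1 / norm v) *\<^sub>C v))"
      using e(1) v(2) by (intro orthonormal_on_Suc) auto
    moreover have "of_real (1 / norm v) *\<^sub>C v \<in> V"
      using assms(1) v(1) by (rule complex_vector.subspace_scale)
    ultimately have "P (Suc r)"
      unfolding P_def using e(2)
      by (intro exI[of _ "e(r := of_real (1 / norm v) *\<^sub>C v)"]) (auto simp: less_Suc_eq)
    then have "Suc r \<le> r"
      unfolding r_def by (rule Greatest_le_nat) (rule length_le)
    then show False by simp
  qed
  with e have "orthonormal_basis V r e"
    by (simp add: orthonormal_basis_def)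
  then show ?thesis
    using that length_le[OF \<open>P r\<close>] by blast
qed

section \<open>Isometries and their wandering subspaces\<close>

text \<open>\<open>T\<^sup>* k = cnj w *\<^sub>C k\<close>, stated without the adjoint.\<close>

definition adjoint_eigenvector :: "('a \<Rightarrow> 'a) \<Rightarrow> complex \<Rightarrow> 'a::complex_inner \<Rightarrow> bool" where
  "adjoint_eigenvector T w k \<longleftrightarrow> (\<forall>x. cinner (T x) k = w * cinner x k)"

lemma adjoint_eigenvectorD: "adjoint_eigenvector T w k \<Longrightarrow> cinner (T x) k = w * cinner x k"
  by (simp add: adjoint_eigenvector_def)

lemma of_real_cmod_sq: "(of_real (cmod w))\<^sup>2 = w * cnj w"
  by (simp add: complex_norm_square flip: of_real_power)

locale complex_isometry =
  fixes T :: "'a::complex_hilbert \<Rightarrow> 'a"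
  assumes T_add: "T (x + y) = T x + T y"
    and T_scaleC: "T (c *\<^sub>C x) = c *\<^sub>C T x"
    and norm_T [simp]: "norm (T x) = norm x"
begin

sublocale T: bounded_linear T
  by (rule bounded_linear_intro[of _ 1]) (simp_all add: T_add T_scaleC scaleR_scaleC)

lemma cinner_T [simp]: "cinner (T x) (T y) = cinner x y"
proof -
  have "inner (T u) (T v) = inner u v" for u v
    using dot_norm[of "T u" "T v"] dot_norm[of u v] by (simp flip: T_add)
  then show ?thesis
    by (simp add: cinner_eq_Complex flip: T_scaleC)
qed

lemma norm_T_pow [simp]: "norm ((T ^^ m) x) = norm x"
  by (induction m) auto

lemma cinner_T_pow [simp]: "cinner ((T ^^ m) x) ((T ^^ m) y) = cinner x y"
  by (induction m) auto

lemma closed_T_image: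
  assumes "subspace K" "closed K" shows "closed (T ` K)"
proof -
  have "complete (T ` K)"
    using assms by (intro complete_isometric_image[of 1] T.bounded_linear_axioms)
                   (auto simp: complete_eq_closed)
  then show ?thesis by (rule complete_imp_closed)
qed

definition resolvent :: "complex \<Rightarrow> 'a \<Rightarrow> 'a" where
  "resolvent w x = (\<Sum>m. (cnj w ^ m) *\<^sub>C (T ^^ m) x)"

lemma resolvent_sums:
  assumes "cmod w < 1" shows "(\<lambda>m. (cnj w ^ m) *\<^sub>C (T ^^ m) x) sums resolvent w x"
proof -
  have "summable (\<lambda>m. norm ((cnj w ^ m) *\<^sub>C (T ^^ m) x))"
    using assms by (simp add: norm_power summable_mult2 summable_geometric)
  then show ?thesis
    unfolding resolvent_def by (rule summable_sums[OF summable_norm_cancel])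
qed

lemma resolvent_eq:
  assumes "cmod w < 1" shows "resolvent w x = x + cnj w *\<^sub>C T (resolvent w x)"
proof -
  have "(\<lambda>m. cnj w *\<^sub>C T ((cnj w ^ m) *\<^sub>C (T ^^ m) x)) sums (cnj w *\<^sub>C T (resolvent w x))"
    by (intro bounded_linear.sums[OF scaleC.bounded_linear_right] T.sums resolvent_sums assms)
  then have "(\<lambda>m. (cnj w ^ Suc m) *\<^sub>C (T ^^ Suc m) x) sums (cnj w *\<^sub>C T (resolvent w x))"
    by (simp add: T_scaleC scaleC_scaleC)
  then have "(\<lambda>m. (cnj w ^ m) *\<^sub>C (T ^^ m) x) sums (cnj w *\<^sub>C T (resolvent w x) + x)"
    by (subst (asm) sums_Suc_iff) simp
  then show ?thesis
    using sums_unique2[OF resolvent_sums[OF assms]] by (metis add.commute)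
qed

lemma norm_resolvent_le:
  assumes "cmod w < 1" shows "norm (resolvent w x) \<le> norm x / (1 - cmod w)"
proof -
  have "norm (resolvent w x) \<le> norm x + cmod w * norm (resolvent w x)"
    using norm_triangle_ineq[of x "cnj w *\<^sub>C T (resolvent w x)"] resolvent_eq[OF assms, of x]
    by simp
  then show ?thesis
    using assms by (simp add: pos_le_divide_eq algebra_simps)
qed

lemma resolvent_identity:
  assumes "cmod w < 1"
  shows "(1 - (cmod w)\<^sup>2) * cinner (resolvent w x) (resolvent w y) =
    cinner x (resolvent w y) + cinner (resolvent w x) y - cinner x y"
proof -
  have "resolvent w u - u = cnj w *\<^sub>C T (resolvent w u)" for u
    using resolvent_eq[OF assms, of u] by (metis add_diff_cancel_left')
  then have "cinner (resolvent w x - x) (resolvent w y - y) =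
      (w * cnj w) * cinner (resolvent w x) (resolvent w y)"
    by simp
  then show ?thesis
    by (simp add: cinner_linear of_real_cmod_sq algebra_simps)
qed

lemma cinner_resolvent_sums:
  assumes "cmod w < 1"
  shows "(\<lambda>m. cinner x ((T ^^ m) y) * w ^ m) sums cinner x (resolvent w y)"
  using bounded_linear.sums[OF cinner.bounded_linear_right resolvent_sums[OF assms]]
  by (simp add: mult.commute)

lemma cinner_resolvent_holomorphic: "(\<lambda>w. cinner x (resolvent w y)) holomorphic_on ball 0 1"
  using power_series_holomorphic[of 0 1 "\<lambda>m. cinner x ((T ^^ m) y)"] cinner_resolvent_sums
  by simp

lemma cinner_resolvent_adjoint_eigenvector:
  assumes "cmod w < 1" "adjoint_eigenvector T w k"
  shows "(1 - (cmod w)\<^sup>2) * cinner (resolvent w x) k = cinner x k"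
proof -
  have "cinner (resolvent w x) k = cinner x k + cinner (cnj w *\<^sub>C T (resolvent w x)) k"
    using resolvent_eq[OF assms(1), of x] by (metis cinner.add_left)
  also have "\<dots> = cinner x k + (w * cnj w) * cinner (resolvent w x) k"
    by (simp add: adjoint_eigenvectorD[OF assms(2)])
  finally show ?thesis
    by (simp add: of_real_cmod_sq algebra_simps)
qed

text \<open>The Herglotz transform of the spectral measure of \<open>T\<close> at \<open>x\<close>.\<close>

definition herglotz :: "'a \<Rightarrow> complex \<Rightarrow> complex" where
  "herglotz x w = 2 * cinner x (resolvent w x) - (norm x)\<^sup>2"

lemma Re_herglotz:
  assumes "cmod w < 1" shows "Re (herglotz x w) = (1 - (cmod w)\<^sup>2) * (norm (resolvent w x))\<^sup>2"
proof -
  have "complex_of_real ((1 - (cmod w)\<^sup>2) * (norm (resolvent w x))\<^sup>2) =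
      cinner x (resolvent w x) + cnj (cinner x (resolvent w x)) - (norm x)\<^sup>2"
    using resolvent_identity[OF assms, of x x] cinner_commute[of "resolvent w x" x]
    by (simp add: cinner_self)
  from arg_cong[OF this, of Re] show ?thesis
    by (simp only: herglotz_def) simp
qed

lemma Re_herglotz_nonneg: "cmod w < 1 \<Longrightarrow> 0 \<le> Re (herglotz x w)"
  by (simp add: Re_herglotz abs_square_le_1)

lemma herglotz_holomorphic: "herglotz x holomorphic_on ball 0 1"
  unfolding herglotz_def[abs_def] by (intro holomorphic_intros cinner_resolvent_holomorphic)

lemma tendsto_herglotz_zero:
  assumes "cmod w < 1" "(h \<longlongrightarrow> 0) F" shows "((\<lambda>n. herglotz (h n) w) \<longlongrightarrow> 0) F"
proof -
  have "((\<lambda>n. resolvent w (h n)) \<longlongrightarrow> 0) F"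
  proof (rule Lim_null_comparison)
    show "\<forall>\<^sub>F n in F. norm (resolvent w (h n)) \<le> norm (h n) / (1 - cmod w)"
      using norm_resolvent_le[OF assms(1)] by simp
    show "((\<lambda>n. norm (h n) / (1 - cmod w)) \<longlongrightarrow> 0) F"
      using tendsto_divide[OF tendsto_norm_zero[OF assms(2)] tendsto_const] assms(1) by simp
  qed
  then have "((\<lambda>n. herglotz (h n) w) \<longlongrightarrow> 2 * cinner 0 (0::'a) - of_real ((norm (0::'a))\<^sup>2)) F"
    unfolding herglotz_def by (intro tendsto_intros assms)
  then show ?thesis
    by (simp add: cinner.zero_left)
qed

lemma cmod_cinner_sq_le_herglotz:
  assumes "cmod w < 1" "adjoint_eigenvector T w k"
  shows "(cmod (cinner x k))\<^sup>2 \<le> (1 - (cmod w)\<^sup>2) * (norm k)\<^sup>2 * Re (herglotz x w)"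
proof -
  define d where "d = 1 - (cmod w)\<^sup>2"
  have "d > 0"
    using assms(1) by (simp add: d_def abs_square_less_1)
  have "cinner x k = of_real d * cinner (resolvent w x) k"
    using cinner_resolvent_adjoint_eigenvector[OF assms] by (simp add: d_def)
  then have "cmod (cinner x k) \<le> d * (norm (resolvent w x) * norm k)"
    using cmod_cinner_le[of "resolvent w x" k] \<open>d > 0\<close> by (simp add: norm_mult)
  from power_mono[OF this norm_ge_zero, of 2] show ?thesis
    unfolding Re_herglotz[OF assms(1)] d_def[symmetric]
    by (simp add: power_mult_distrib power2_eq_square mult_ac)
qed

end

locale invariant_subspace = complex_isometry T for T :: "'a::complex_hilbert \<Rightarrow> 'a" +
  fixes K :: "'a set"
  assumes csubspace_K: "csubspace K" and closed_K: "closed K"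
    and T_mem: "x \<in> K \<Longrightarrow> T x \<in> K"
begin

definition wandering :: "'a set" where
  "wandering = {x \<in> K. \<forall>y\<in>K. cinner (T y) x = 0}"

lemma csubspace_wandering: "csubspace wandering"
  using csubspace_K unfolding wandering_def
  by (intro complex_vector.subspaceI)
     (auto simp: complex_vector.subspace_0 complex_vector.subspace_add
       complex_vector.subspace_scale cinner_add_right cinner.zero_right)

lemma wandering_mem: "x \<in> wandering \<Longrightarrow> x \<in> K"
  by (simp add: wandering_def)

lemma cinner_T_wandering: "y \<in> K \<Longrightarrow> J \<in> wandering \<Longrightarrow> cinner (T y) J = 0"
  by (simp add: wandering_def)

lemma T_pow_mem: "x \<in> K \<Longrightarrow> (T ^^ m) x \<in> K"
  by (induction m) (auto intro: T_mem)

lemma resolvent_mem: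
  assumes "cmod w < 1" "x \<in> K" shows "resolvent w x \<in> K"
proof (rule closed_sequentially[OF closed_K])
  show "(\<Sum>m<N. (cnj w ^ m) *\<^sub>C (T ^^ m) x) \<in> K" for N
    by (intro complex_vector.subspace_sum complex_vector.subspace_scale csubspace_K T_pow_mem assms)
  show "(\<lambda>N. \<Sum>m<N. (cnj w ^ m) *\<^sub>C (T ^^ m) x) \<longlonglongrightarrow> resolvent w x"
    using resolvent_sums[OF assms(1)] by (simp add: sums_def)
qed

lemma cinner_resolvent_wandering:
  assumes "cmod w < 1" "x \<in> K" "J \<in> wandering" shows "cinner (resolvent w x) J = cinner x J"
proof -
  have "cinner (resolvent w x) J = cinner x J + cinner (cnj w *\<^sub>C T (resolvent w x)) J"
    using resolvent_eq[OF assms(1), of x] by (metis cinner.add_left)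
  then show ?thesis
    by (simp add: cinner_T_wandering resolvent_mem assms)
qed

lemma cinner_resolvent_resolvent_wandering:
  assumes "cmod w < 1" "x \<in> K" "J \<in> wandering"
  shows "(1 - (cmod w)\<^sup>2) * cinner (resolvent w x) (resolvent w J) = cinner x (resolvent w J)"
  using resolvent_identity[OF assms(1), of x J] cinner_resolvent_wandering[OF assms] by simp

lemma cinner_wandering_resolvent_wandering:
  assumes "cmod w < 1" "I \<in> wandering" "J \<in> wandering"
  shows "cinner I (resolvent w J) = cinner I J"
  using cinner_resolvent_wandering[OF assms(1) wandering_mem[OF assms(3)] assms(2)]
  by (metis cinner_commute)

lemma cinner_T_resolvent_wandering:
  assumes "cmod w < 1" "x \<in> K" "J \<in> wandering"
  shows "cinner (T x) (resolvent w J) = w * cinner x (resolvent w J)"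
proof -
  have "cinner (T x) (resolvent w J) = cinner (T x) J + cinner (T x) (cnj w *\<^sub>C T (resolvent w J))"
    using resolvent_eq[OF assms(1), of J] by (metis cinner.add_right)
  then show ?thesis
    by (simp add: cinner_T_wandering assms)
qed

lemma cinner_T_pow_resolvent_wandering:
  assumes "cmod w < 1" "I \<in> wandering" "J \<in> wandering"
  shows "cinner ((T ^^ m) I) (resolvent w J) = w ^ m * cinner I J"
proof (induction m)
  case (Suc m)
  have "(T ^^ m) I \<in> K"
    by (intro T_pow_mem wandering_mem assms)
  with Suc show ?case
    by (simp add: cinner_T_resolvent_wandering assms)
qed (simp add: cinner_wandering_resolvent_wandering assms)

lemma cinner_T_pow_wandering:
  assumes "I \<in> wandering" "J \<in> wandering"
  shows "cinner ((T ^^ m) I) ((T ^^ k) J) = (if m = k then cinner I J else 0)"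
proof -
  have shifted: "cinner ((T ^^ (k + Suc d)) I) ((T ^^ k) J) = 0"
    if "I \<in> wandering" "J \<in> wandering" for k d I J
    unfolding funpow_add comp_apply cinner_T_pow
    using that by (simp add: cinner_T_wandering T_pow_mem wandering_mem)
  show ?thesis
  proof (cases m k rule: linorder_cases)
    case less
    then obtain d where "k = m + Suc d"
      using less_iff_Suc_add by auto
    then show ?thesis
      using shifted[OF assms(2,1), of m d] cinner_commute[of "(T ^^ m) I"] by simp
  next
    case greater
    then obtain d where "m = k + Suc d"
      using less_iff_Suc_add by auto
    then show ?thesis
      using shifted[OF assms, of k d] by simp
  qed simp
qed

lemma orthonormal_on_resolvent:
  assumes w: "cmod w < 1" and e: "orthonormal_on I e" "e ` I \<subseteq> wandering"
  shows "orthonormal_on I (\<lambda>i. of_real (sqrt (1 - (cmod w)\<^sup>2)) *\<^sub>C resolvent w (e i))"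
  unfolding orthonormal_on_def
proof (intro ballI)
  fix i j assume ij: "i \<in> I" "j \<in> I"
  define d where "d = 1 - (cmod w)\<^sup>2"
  define u where "u i = of_real (sqrt d) *\<^sub>C resolvent w (e i)" for i
  have "of_real (sqrt d) * of_real (sqrt d) = complex_of_real d"
    using w by (simp add: d_def abs_square_le_1 flip: of_real_mult)
  then have "cinner (u i) (u j) = of_real d * cinner (resolvent w (e i)) (resolvent w (e j))"
    by (simp add: u_def mult.assoc[symmetric])
  also have "\<dots> = cinner (e i) (e j)"
    using cinner_resolvent_resolvent_wandering[OF w wandering_mem] e(2) ij
      cinner_wandering_resolvent_wandering[OF w] by (simp add: d_def image_subset_iff)
  finally show "cinner (of_real (sqrt (1 - (cmod w)\<^sup>2)) *\<^sub>C resolvent w (e i))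
      (of_real (sqrt (1 - (cmod w)\<^sup>2)) *\<^sub>C resolvent w (e j)) = (if i = j then 1 else 0)"
    using orthonormal_onD[OF e(1) ij] by (simp add: u_def d_def)
qed

lemma sum_wandering_adjoint_eigenvector_le:
  assumes w: "cmod w < 1" and k: "adjoint_eigenvector T w k"
    and e: "orthonormal_on I e" "e ` I \<subseteq> wandering" "finite I"
  shows "(\<Sum>i\<in>I. (cmod (cinner (e i) k))\<^sup>2) \<le> (1 - (cmod w)\<^sup>2) * (norm k)\<^sup>2"
proof -
  define d where "d = 1 - (cmod w)\<^sup>2"
  define u where "u i = of_real (sqrt d) *\<^sub>C resolvent w (e i)" for i
  have "d > 0"
    using w by (simp add: d_def abs_square_less_1)
  have "(cmod (cinner (e i) k))\<^sup>2 = d * (cmod (cinner k (u i)))\<^sup>2" for i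
  proof -
    have "cinner (e i) k = of_real d * cinner (resolvent w (e i)) k"
      using cinner_resolvent_adjoint_eigenvector[OF w k] by (simp add: d_def)
    moreover have "cmod (cinner k (u i)) = sqrt d * cmod (cinner (resolvent w (e i)) k)"
      using \<open>d > 0\<close> cinner_commute[of k] by (simp add: u_def norm_mult)
    ultimately show ?thesis
      using \<open>d > 0\<close> by (simp add: norm_mult power_mult_distrib power2_eq_square)
  qed
  then have "(\<Sum>i\<in>I. (cmod (cinner (e i) k))\<^sup>2) = d * (\<Sum>i\<in>I. (cmod (cinner k (u i)))\<^sup>2)"
    by (simp add: sum_distrib_left)
  also have "\<dots> \<le> d * (norm k)\<^sup>2"
    using orthonormal_on_resolvent[OF w e(1,2)] \<open>d > 0\<close> \<open>finite I\<close>
    by (intro mult_left_mono Bessel_inequality) (simp_all add: u_def d_def)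
  finally show ?thesis by (simp add: d_def)
qed

lemma wandering_decomposition:
  assumes "x \<in> K" obtains y v where "y \<in> K" "v \<in> wandering" "x = T y + v"
proof -
  have "csubspace (T ` K)"
    using csubspace_K
    by (auto simp: complex_vector.subspace_def simp flip: T_add T_scaleC
        intro!: image_eqI[of 0 T 0])
  moreover have "closed (T ` K)"
    by (intro closed_T_image csubspace_imp_subspace csubspace_K closed_K)
  ultimately obtain p where "p \<in> T ` K" and orth: "\<And>s. s \<in> T ` K \<Longrightarrow> cinner (x - p) s = 0"
    using complex_orthogonal_projection by blast
  then obtain y where y: "y \<in> K" "p = T y" by blast
  have "x - p \<in> K"
    using complex_vector.subspace_diff[OF csubspace_K assms] T_mem y by blast
  moreover have "cinner (T u) (x - p) = 0" if "u \<in> K" for u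
    using orth[of "T u"] that cinner_commute[of "T u"] by simp
  ultimately show ?thesis
    using that[of y "x - p"] y by (simp add: wandering_def)
qed

lemma orthogonal_imp_mem_range_T_pow:
  assumes e: "orthonormal_basis wandering r e"
    and x: "x \<in> K" "\<And>m i. i < r \<Longrightarrow> cinner x ((T ^^ m) (e i)) = 0"
  shows "\<exists>y\<in>K. x = (T ^^ m) y \<and> (\<forall>k. \<forall>i<r. cinner y ((T ^^ k) (e i)) = 0)"
proof (induction m)
  case 0
  show ?case using x by auto
next
  case (Suc m)
  then obtain y where y: "y \<in> K" "x = (T ^^ m) y" "\<forall>k. \<forall>i<r. cinner y ((T ^^ k) (e i)) = 0"
    by blast
  obtain u v where uv: "u \<in> K" "v \<in> wandering" "y = T u + v"
    using wandering_decomposition[OF y(1)] .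
  have "cinner v (e i) = 0" if "i < r" for i
    using y(3)[rule_format, OF that, of 0] uv(1) e that
    by (auto simp: uv(3) cinner.add_left cinner_T_wandering orthonormal_basis_def image_subset_iff)
  then have "v = 0"
    using e uv(2) by (simp add: orthonormal_basis_def)
  then have "cinner u ((T ^^ k) (e i)) = 0" if "i < r" for k i
    using y(3)[rule_format, OF that, of "Suc k"] by (simp add: uv(3))
  then show ?case
    using uv y(2) \<open>v = 0\<close> by (intro bexI[of _ u]) (simp_all add: funpow_swap1)
qed

end

locale shift_invariant_subspace = invariant_subspace T K
  for T :: "'a::complex_hilbert \<Rightarrow> 'a" and K +
  assumes pure: "(\<And>m. x \<in> range (T ^^ m)) \<Longrightarrow> x = 0"
begin

lemma wandering_powers_total:
  assumes "orthonormal_basis wandering r e"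
    and "x \<in> K" "\<And>m i. i < r \<Longrightarrow> cinner x ((T ^^ m) (e i)) = 0"
  shows "x = 0"
  using orthogonal_imp_mem_range_T_pow[OF assms] by (intro pure) blast

lemma wandering_expansion:
  assumes e: "orthonormal_basis wandering r e" and "x \<in> K"
    and w: "cmod w < 1" and k: "adjoint_eigenvector T w k"
  shows "cinner x k = (\<Sum>i<r. cinner (e i) k * cinner x (resolvent w (e i)))"
proof -
  have e_mem: "e i \<in> wandering" if "i < r" for i
    using e that by (auto simp: orthonormal_basis_def)
  have orthonormal: "orthonormal_on {..<r} e"
    using e by (simp add: orthonormal_basis_def)
  define L where "L x = cinner x k - (\<Sum>i<r. cinner (e i) k * cinner x (resolvent w (e i)))" for x
  interpret L: bounded_linear L
    unfolding L_def
    by (intro bounded_linear_sub bounded_linear_sum bounded_linear_const_mult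
        cinner.bounded_linear_left)
  have "L (c *\<^sub>C x) = c * L x" for c x
    by (simp add: L_def right_diff_distrib sum_distrib_left mult.left_commute)
  then have "csubspace {x \<in> K. L x = 0}"
    using csubspace_K by (auto simp: complex_vector.subspace_def L.add)
  moreover have "closed {x \<in> K. L x = 0}"
    using closed_K L.continuous_on[OF continuous_on_id, of UNIV]
    by (auto intro!: closed_Collect_conj closed_Collect_eq)
  moreover have "(T ^^ m) (e i) \<in> {x \<in> K. L x = 0}" if i: "i < r" for m i
  proof -
    have "cinner ((T ^^ m) (e i)) k = w ^ m * cinner (e i) k"
      by (induction m) (simp_all add: adjoint_eigenvectorD[OF k])
    moreover have "(\<Sum>j<r. cinner (e j) k * cinner ((T ^^ m) (e i)) (resolvent w (e j))) =
        (\<Sum>j<r. if j = i then w ^ m * cinner (e j) k else 0)"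
      using i e_mem orthonormal_onD[OF orthonormal, of i]
      by (intro sum.cong) (auto simp: cinner_T_pow_resolvent_wandering[OF w])
    ultimately show ?thesis
      using i by (simp add: L_def T_pow_mem wandering_mem e_mem)
  qed
  ultimately have "{x \<in> K. L x = 0} = K"
    by (intro closed_csubspace_eqI csubspace_K wandering_powers_total[OF e]) auto
  then show ?thesis
    using \<open>x \<in> K\<close> by (auto simp: L_def)
qed

lemma cmod_cinner_resolvent_wandering_sq_le:
  assumes w: "cmod w < 1" and "x \<in> K" "J \<in> wandering" "norm J = 1"
  shows "(cmod (cinner x (resolvent w J)))\<^sup>2 \<le> (1 - (cmod w)\<^sup>2) * (norm (resolvent w x))\<^sup>2"
proof -
  define d where "d = 1 - (cmod w)\<^sup>2"
  have "d > 0"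
    using w by (simp add: d_def abs_square_less_1)
  have "complex_of_real (d * (norm (resolvent w J))\<^sup>2) = of_real 1"
    using cinner_resolvent_resolvent_wandering[OF w wandering_mem, of J J]
      cinner_wandering_resolvent_wandering[OF w, of J J] assms(3,4)
    by (simp add: d_def cinner_self)
  then have J: "d * (norm (resolvent w J))\<^sup>2 = 1"
    by (simp only: of_real_eq_iff)
  have "cinner x (resolvent w J) = of_real d * cinner (resolvent w x) (resolvent w J)"
    using cinner_resolvent_resolvent_wandering[OF assms(1-3)] by (simp add: d_def)
  then have "cmod (cinner x (resolvent w J)) \<le> d * (norm (resolvent w x) * norm (resolvent w J))"
    using cmod_cinner_le[of "resolvent w x" "resolvent w J"] \<open>d > 0\<close> by (simp add: norm_mult)
  from power_mono[OF this norm_ge_zero, of 2]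
  have "(cmod (cinner x (resolvent w J)))\<^sup>2
      \<le> (d * (norm (resolvent w J))\<^sup>2) * (d * (norm (resolvent w x))\<^sup>2)"
    by (simp add: power_mult_distrib power2_eq_square mult_ac)
  then show ?thesis
    unfolding J by (simp add: d_def)
qed

end

section \<open>The Hardy space\<close>

lemma summable_sq_add:
  fixes a b :: "nat \<Rightarrow> complex"
  assumes "summable (\<lambda>k. (cmod (a k))\<^sup>2)" "summable (\<lambda>k. (cmod (b k))\<^sup>2)"
  shows "summable (\<lambda>k. (cmod (a k + b k))\<^sup>2)"
proof (rule summable_comparison_test')
  show "summable (\<lambda>k. 2 * ((cmod (a k))\<^sup>2 + (cmod (b k))\<^sup>2))"
    by (intro summable_mult summable_add assms)
  show "norm ((cmod (a k + b k))\<^sup>2) \<le> 2 * ((cmod (a k))\<^sup>2 + (cmod (b k))\<^sup>2)" for k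
  proof -
    have "(cmod (a k + b k))\<^sup>2 \<le> (cmod (a k) + cmod (b k))\<^sup>2"
      by (simp add: power_mono norm_triangle_ineq)
    also have "\<dots> \<le> 2 * ((cmod (a k))\<^sup>2 + (cmod (b k))\<^sup>2)"
      using sum_squares_bound[of "cmod (a k)" "cmod (b k)"] by (simp add: power2_sum algebra_simps)
    finally show ?thesis by simp
  qed
qed

lemma summable_sq_scale:
  fixes a :: "nat \<Rightarrow> complex"
  assumes "summable (\<lambda>k. (cmod (a k))\<^sup>2)"
  shows "summable (\<lambda>k. (cmod (c * a k))\<^sup>2)"
  using summable_mult[OF assms, of "(cmod c)\<^sup>2"] by (simp add: norm_mult power_mult_distrib)

lemma summable_cmod_mult_of_sq:
  fixes a b :: "nat \<Rightarrow> complex"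
  assumes "summable (\<lambda>k. (cmod (a k))\<^sup>2)" "summable (\<lambda>k. (cmod (b k))\<^sup>2)"
  shows "summable (\<lambda>k. cmod (a k * b k))"
proof (rule summable_comparison_test')
  show "summable (\<lambda>k. (cmod (a k))\<^sup>2 + (cmod (b k))\<^sup>2)"
    by (intro summable_add assms)
  show "norm (cmod (a k * b k)) \<le> (cmod (a k))\<^sup>2 + (cmod (b k))\<^sup>2" for k
    using sum_squares_bound[of "cmod (a k)" "cmod (b k)"]
      mult_nonneg_nonneg[OF norm_ge_zero[of "a k"] norm_ge_zero[of "b k"]]
    unfolding norm_mult abs_norm_cancel real_norm_def abs_mult by linarith
qed

typedef h2 = "{a :: nat \<Rightarrow> complex. summable (\<lambda>k. (cmod (a k))\<^sup>2)}"
  morphisms coef Abs_h2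
  by (rule exI[of _ "\<lambda>_. 0"]) simp

setup_lifting type_definition_h2

lemma summable_coef: "summable (\<lambda>k. (cmod (coef a k))\<^sup>2)"
  using coef[of a] by simp

lemma coef_Abs_h2: "summable (\<lambda>k. (cmod (a k))\<^sup>2) \<Longrightarrow> coef (Abs_h2 a) = a"
  by (simp add: Abs_h2_inverse)

lemma h2_eqI: "(\<And>k. coef a k = coef b k) \<Longrightarrow> a = b"
  using coef_inject by blast

lemma summable_coef_mult_cnj: "summable (\<lambda>k. coef a k * cnj (coef b k))"
  using summable_cmod_mult_of_sq[of "coef a" "\<lambda>k. cnj (coef b k)"] summable_coef
  by (simp add: summable_norm_cancel)

instantiation h2 :: complex_inner
begin

lift_definition zero_h2 :: h2 is "\<lambda>_. 0" by simp
lift_definition plus_h2 :: "h2 \<Rightarrow> h2 \<Rightarrow> h2" is "\<lambda>a b k. a k + b k" by (rule summable_sq_add)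
lift_definition uminus_h2 :: "h2 \<Rightarrow> h2" is "\<lambda>a k. - a k" by simp
lift_definition scaleC_h2 :: "complex \<Rightarrow> h2 \<Rightarrow> h2" is "\<lambda>c a k. c * a k"
  by (rule summable_sq_scale)
definition minus_h2 :: "h2 \<Rightarrow> h2 \<Rightarrow> h2" where "minus_h2 a b = a + - b"
definition scaleR_h2 :: "real \<Rightarrow> h2 \<Rightarrow> h2" where "scaleR_h2 r a = of_real r *\<^sub>C a"
definition cinner_h2 :: "h2 \<Rightarrow> h2 \<Rightarrow> complex"
  where "cinner_h2 a b = (\<Sum>k. coef a k * cnj (coef b k))"
definition inner_h2 :: "h2 \<Rightarrow> h2 \<Rightarrow> real" where "inner_h2 a b = Re (cinner a b)"
definition norm_h2 :: "h2 \<Rightarrow> real" where "norm_h2 a = sqrt (inner a a)"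
definition dist_h2 :: "h2 \<Rightarrow> h2 \<Rightarrow> real" where "dist_h2 a b = norm (a - b)"
definition sgn_h2 :: "h2 \<Rightarrow> h2" where "sgn_h2 a = scaleR (inverse (norm a)) a"
definition uniformity_h2 :: "(h2 \<times> h2) filter"
  where "uniformity_h2 = (INF e\<in>{0 <..}. principal {(x, y). dist x y < e})"
definition open_h2 :: "h2 set \<Rightarrow> bool"
  where "open_h2 U \<longleftrightarrow> (\<forall>x\<in>U. eventually (\<lambda>(x', y). x' = x \<longrightarrow> y \<in> U) uniformity)"

instance
proof
  fix a b c :: h2 and r s :: real and u v :: complex
  show "a + b + c = a + (b + c)" "a + b = b + a" "0 + a = a" "- a + a = 0"
    "u *\<^sub>C (a + b) = u *\<^sub>C a + u *\<^sub>C b" "(u + v) *\<^sub>C a = u *\<^sub>C a + v *\<^sub>C a"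
    "u *\<^sub>C v *\<^sub>C a = (u * v) *\<^sub>C a"
    by (transfer; simp add: algebra_simps)+
  show "r *\<^sub>R (a + b) = r *\<^sub>R a + r *\<^sub>R b" "(r + s) *\<^sub>R a = r *\<^sub>R a + s *\<^sub>R a"
    "r *\<^sub>R s *\<^sub>R a = (r * s) *\<^sub>R a" "1 *\<^sub>R a = a"
    unfolding scaleR_h2_def by (transfer; simp add: algebra_simps)+
  show add_left: "cinner (a + b) c = cinner a c + cinner b c" for a b c :: h2
    using suminf_add[OF summable_coef_mult_cnj[of a c] summable_coef_mult_cnj[of b c]]
    by (simp add: cinner_h2_def plus_h2.rep_eq distrib_right)
  show scale_left: "cinner (u *\<^sub>C a) b = u * cinner a b" for u and a b :: h2
    using suminf_mult[OF summable_coef_mult_cnj[of a b], of u]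
    by (simp add: cinner_h2_def scaleC_h2.rep_eq mult.assoc)
  show commute: "cinner a b = cnj (cinner b a)" for a b :: h2
    using sums_unique[OF sums_cnj[THEN iffD2, OF summable_sums[OF summable_coef_mult_cnj[of b a]]]]
    by (simp add: cinner_h2_def mult.commute)
  have self: "inner a a = (\<Sum>k. (cmod (coef a k))\<^sup>2)"
    unfolding inner_h2_def cinner_h2_def Re_suminf[OF summable_coef_mult_cnj]
    by (simp only: complex_norm_square[symmetric] Re_complex_of_real)
  show "inner a b = inner b a"
    unfolding inner_h2_def using commute[of a b] by simp
  show "inner (a + b) c = inner a c + inner b c" "inner (r *\<^sub>R a) b = r * inner a b"
    by (simp_all add: inner_h2_def add_left scale_left scaleR_h2_def)
  show "0 \<le> inner a a"
    unfolding self by (intro suminf_nonneg summable_coef) simp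
  show "inner a a = 0 \<longleftrightarrow> a = 0"
  proof
    assume "inner a a = 0"
    then show "a = 0"
      unfolding self suminf_eq_zero_iff[OF summable_coef zero_le_power2]
      by (intro h2_eqI) (simp add: zero_h2.rep_eq)
  next
    assume "a = 0"
    then show "inner a a = 0"
      unfolding self by (simp add: zero_h2.rep_eq)
  qed
qed (rule minus_h2_def scaleR_h2_def inner_h2_def norm_h2_def dist_h2_def sgn_h2_def
      uniformity_h2_def open_h2_def)+

end

lemma coef_simps [simp]:
  "coef 0 k = 0" "coef (a + b) k = coef a k + coef b k" "coef (- a) k = - coef a k"
  "coef (c *\<^sub>C a) k = c * coef a k"
  by (simp_all add: zero_h2.rep_eq plus_h2.rep_eq uminus_h2.rep_eq scaleC_h2.rep_eq)

lemma coef_diff [simp]: "coef (a - b) k = coef a k - coef b k"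
  unfolding minus_h2_def by (simp only: coef_simps) simp

lemma cinner_h2_sums: "(\<lambda>k. coef a k * cnj (coef b k)) sums cinner a b"
  unfolding cinner_h2_def by (rule summable_sums[OF summable_coef_mult_cnj])

lemma norm_h2_sq_sums: "(\<lambda>k. (cmod (coef a k))\<^sup>2) sums (norm a)\<^sup>2"
proof -
  have "(\<lambda>k. complex_of_real ((cmod (coef a k))\<^sup>2)) sums of_real ((norm a)\<^sup>2)"
    unfolding complex_norm_square cinner_self[symmetric] by (rule cinner_h2_sums)
  then show ?thesis
    by (simp only: sums_of_real_iff)
qed

lemma sum_cmod_coef_sq_le: "finite A \<Longrightarrow> (\<Sum>k\<in>A. (cmod (coef a k))\<^sup>2) \<le> (norm a)\<^sup>2"
  unfolding sums_unique[OF norm_h2_sq_sums] by (intro sum_le_suminf summable_coef) auto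

lemma cmod_coef_le: "cmod (coef a k) \<le> norm a"
  using sum_cmod_coef_sq_le[of "{k}" a] by (auto intro: power2_le_imp_le)

lemma h2_of_bounded_partial_sums:
  assumes "\<And>N. (\<Sum>k<N. (cmod (u k))\<^sup>2) \<le> C\<^sup>2" "C \<ge> 0"
  obtains a where "coef a = u" "norm a \<le> C"
proof -
  have u: "summable (\<lambda>k. (cmod (u k))\<^sup>2)"
    by (rule summableI_nonneg_bounded[OF _ assms(1)]) simp
  have "(norm (Abs_h2 u))\<^sup>2 \<le> C\<^sup>2"
    unfolding sums_unique[OF norm_h2_sq_sums] coef_Abs_h2[OF u]
    by (rule suminf_le_const[OF u assms(1)])
  with coef_Abs_h2[OF u] \<open>C \<ge> 0\<close> that show ?thesis
    using power2_le_imp_le by blast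
qed

lemma h2_coef_limit:
  assumes lim: "\<And>k. (\<lambda>n. coef (a n) k) \<longlonglongrightarrow> u k"
    and bounded: "\<forall>\<^sub>F n in sequentially. norm (a n) \<le> C" "C \<ge> 0"
  obtains b where "coef b = u" "norm b \<le> C"
proof (rule h2_of_bounded_partial_sums[OF _ \<open>C \<ge> 0\<close>, of u])
  fix N
  show "(\<Sum>k<N. (cmod (u k))\<^sup>2) \<le> C\<^sup>2"
  proof (rule tendsto_upperbound)
    show "(\<lambda>n. \<Sum>k<N. (cmod (coef (a n) k))\<^sup>2) \<longlonglongrightarrow> (\<Sum>k<N. (cmod (u k))\<^sup>2)"
      by (intro tendsto_intros lim)
    show "\<forall>\<^sub>F n in sequentially. (\<Sum>k<N. (cmod (coef (a n) k))\<^sup>2) \<le> C\<^sup>2"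
      using bounded(1)
    proof eventually_elim
      case (elim n)
      then show ?case
        using sum_cmod_coef_sq_le[of "{..<N}" "a n"] power_mono[of "norm (a n)" C 2] by simp
    qed
  qed simp
qed (rule that)

lemma Cauchy_coef:
  assumes "Cauchy X" shows "Cauchy (\<lambda>n. coef (X n) k)"
  unfolding Cauchy_def
proof (intro allI impI)
  fix e :: real assume "e > 0"
  have "dist (coef (X m) k) (coef (X n) k) \<le> dist (X m) (X n)" for m n
    using cmod_coef_le[of "X m - X n" k] by (simp add: dist_norm)
  then show "\<exists>N. \<forall>m\<ge>N. \<forall>n\<ge>N. dist (coef (X m) k) (coef (X n) k) < e"
    using metric_CauchyD[OF assms \<open>e > 0\<close>] by (meson le_less_trans)
qed

lemma Cauchy_coef_LIMSEQ:
  assumes X: "Cauchy X" and lim: "\<And>k. (\<lambda>n. coef (X n) k) \<longlonglongrightarrow> coef L k"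
  shows "X \<longlonglongrightarrow> L"
proof (rule metric_LIMSEQ_I)
  fix e :: real assume "e > 0"
  then obtain N where N: "\<And>m n. m \<ge> N \<Longrightarrow> n \<ge> N \<Longrightarrow> dist (X m) (X n) < e / 2"
    using metric_CauchyD[OF X, of "e / 2"] by auto
  have "dist (X m) L < e" if "m \<ge> N" for m
  proof -
    have "\<exists>b. coef b = (\<lambda>k. coef (X m) k - coef L k) \<and> norm b \<le> e / 2"
    proof (rule h2_coef_limit[of "\<lambda>n. X m - X n"])
      show "(\<lambda>n. coef (X m - X n) k) \<longlonglongrightarrow> coef (X m) k - coef L k" for k
        by (simp add: tendsto_diff lim)
      show "\<forall>\<^sub>F n in sequentially. norm (X m - X n) \<le> e / 2"
        using eventually_ge_at_top[of N]
        by eventually_elim (use N[OF that] in \<open>auto simp: dist_norm intro: less_imp_le\<close>)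
    qed (use \<open>e > 0\<close> in auto)
    then obtain b where "coef b = (\<lambda>k. coef (X m) k - coef L k)" and b: "norm b \<le> e / 2"
      by blast
    then have "X m - L = b"
      by (intro h2_eqI) simp
    with b show ?thesis
      using \<open>e > 0\<close> by (simp add: dist_norm)
  qed
  then show "\<exists>N. \<forall>m\<ge>N. dist (X m) L < e" by blast
qed

instance h2 :: complex_hilbert
proof
  fix X :: "nat \<Rightarrow> h2" assume X: "Cauchy X"
  obtain u where u: "\<And>k. (\<lambda>n. coef (X n) k) \<longlonglongrightarrow> u k"
    using Cauchy_coef[OF X] unfolding Cauchy_convergent_iff convergent_def by metis
  obtain C where "\<And>n. norm (X n) \<le> C"
    using cauchy_imp_bounded[OF X] by (auto simp: bounded_iff)
  then have "\<forall>\<^sub>F n in sequentially. norm (X n) \<le> C" "C \<ge> 0"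
    using order_trans[OF norm_ge_zero, of "X 0" C] by simp_all
  then obtain L where "coef L = u"
    using h2_coef_limit[OF u] by blast
  with u have "X \<longlonglongrightarrow> L"
    by (intro Cauchy_coef_LIMSEQ X) simp
  then show "convergent X"
    by (auto simp: convergent_def)
qed

definition ev :: "h2 \<Rightarrow> complex \<Rightarrow> complex" where
  "ev a z = (if cmod z < 1 then \<Sum>k. coef a k * z ^ k else 0)"

definition szego :: "complex \<Rightarrow> h2" where
  "szego w = Abs_h2 (\<lambda>k. cnj w ^ k)"

lemma coef_szego:
  assumes "cmod w < 1" shows "coef (szego w) k = cnj w ^ k"
proof -
  have "summable (\<lambda>k. ((cmod w)\<^sup>2) ^ k)"
    using assms by (intro summable_geometric) (simp add: abs_square_less_1)
  then show ?thesis
    by (simp add: szego_def coef_Abs_h2 norm_power power_mult[symmetric] mult.commute)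
qed

lemma cinner_szego: "cmod w < 1 \<Longrightarrow> cinner a (szego w) = ev a w"
  by (simp add: cinner_h2_def coef_szego ev_def)

lemma ev_outside [simp]: "\<not> cmod z < 1 \<Longrightarrow> ev a z = 0"
  by (simp add: ev_def)

lemma ev_sums: "cmod z < 1 \<Longrightarrow> (\<lambda>k. coef a k * z ^ k) sums ev a z"
  using cinner_h2_sums[of a "szego z"] by (simp add: coef_szego cinner_szego)

lemma ev_holomorphic: "ev a holomorphic_on ball 0 1"
  using power_series_holomorphic[of 0 1 "coef a" "ev a"] ev_sums[of _ a] by simp

lemma ev_eqI:
  "(\<And>z. cmod z < 1 \<Longrightarrow> ev a z = f z) \<Longrightarrow> (\<And>z. \<not> cmod z < 1 \<Longrightarrow> f z = 0) \<Longrightarrow> ev a = f"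
  by (metis ev_outside ext)

lemma ev_simps [simp]:
  "ev 0 z = 0" "ev (a + b) z = ev a z + ev b z" "ev (a - b) z = ev a z - ev b z"
  "ev (c *\<^sub>C a) z = c * ev a z"
  by (cases "cmod z < 1"; simp add: cinner.zero_left cinner_linear flip: cinner_szego)+

lemma ev_sum: "ev (sum f A) z = (\<Sum>i\<in>A. ev (f i) z)"
  by (induction A rule: infinite_finite_induct) simp_all

lemma tendsto_ev [tendsto_intros]:
  assumes "(s \<longlongrightarrow> a) F" shows "((\<lambda>n. ev (s n) z) \<longlongrightarrow> ev a z) F"
proof (cases "cmod z < 1")
  case True
  then show ?thesis
    using tendsto_cinner[OF assms tendsto_const, of "szego z"] by (simp add: cinner_szego)
qed simp

lemma ev_eq_0_imp_coef_eq_0: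
  assumes "\<And>z. ev a z = 0" shows "coef a k = 0"
proof (rule ccontr)
  assume "coef a k \<noteq> 0"
  moreover have "coef a 0 = 0"
    using assms[of 0] by (simp add: ev_def)
  ultimately obtain s where "0 < s" "\<And>z. z \<in> cball 0 s - {0} \<Longrightarrow> ev a z \<noteq> 0"
    using powser_0_nonzero[of 1 0 "coef a" "ev a" k] ev_sums[of _ a] assms[of 0]
    by (metis diff_zero gr0I zero_less_one)
  then show False
    using assms[of "of_real s"] by (force simp: dist_norm)
qed

lemma ev_inject: "ev a = ev b \<longleftrightarrow> a = b"
proof
  assume "ev a = ev b"
  then have "ev (a - b) z = 0" for z by simp
  then show "a = b"
    using ev_eq_0_imp_coef_eq_0[of "a - b"] by (intro h2_eqI) simp
qed simp

lemma szego_total: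
  assumes "\<And>w. cmod w < 1 \<Longrightarrow> cinner a (szego w) = 0" shows "a = 0"
proof -
  have "ev a z = 0" for z
    using assms[of z] by (cases "cmod z < 1") (simp_all add: cinner_szego)
  then show ?thesis
    using ev_inject[of a 0] by (simp add: fun_eq_iff)
qed

lemma tendsto_cinner_of_pointwise:
  assumes "\<And>n. norm (a n) \<le> C"
    and lim: "\<And>z. cmod z < 1 \<Longrightarrow> ((\<lambda>n. ev (a n) z) \<longlongrightarrow> ev b z) F"
  shows "((\<lambda>n. cinner (a n) y) \<longlongrightarrow> cinner b y) F"
proof (rule tendsto_cinner_of_total)
  show "x = 0" if "\<And>k. k \<in> szego ` ball 0 1 \<Longrightarrow> cinner x k = 0" for x
    using that by (intro szego_total) simp
  show "((\<lambda>n. cinner (a n) k) \<longlongrightarrow> cinner b k) F" if "k \<in> szego ` ball 0 1" for k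
    using that lim by (auto simp: cinner_szego)
qed fact

lemma cmod_cnj_mult_less_1: "cmod w < 1 \<Longrightarrow> cmod z < 1 \<Longrightarrow> cmod (cnj w * z) < 1"
  using mult_strict_mono'[of "cmod w" 1 "cmod z" 1] by (simp add: norm_mult)

lemma one_minus_cnj_mult_nonzero: "cmod w < 1 \<Longrightarrow> cmod z < 1 \<Longrightarrow> 1 - cnj w * z \<noteq> 0"
  using cmod_cnj_mult_less_1[of w z] by auto

lemma ev_szego: "cmod w < 1 \<Longrightarrow> cmod z < 1 \<Longrightarrow> ev (szego w) z = 1 / (1 - cnj w * z)"
  using cmod_cnj_mult_less_1[of w z]
  by (simp add: ev_def coef_szego power_mult_distrib[symmetric] suminf_geometric)

lemma norm_szego_sq:
  assumes "cmod w < 1" shows "(norm (szego w))\<^sup>2 = 1 / (1 - (cmod w)\<^sup>2)"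
proof -
  have "complex_of_real ((norm (szego w))\<^sup>2) = 1 / (1 - cnj w * w)"
    by (simp only: cinner_self[symmetric] cinner_szego[OF assms] ev_szego[OF assms assms])
  also have "\<dots> = of_real (1 / (1 - (cmod w)\<^sup>2))"
    by (simp add: of_real_cmod_sq mult.commute)
  finally show ?thesis by (simp only: of_real_eq_iff)
qed

lemma norm_szego_0 [simp]: "norm (szego 0) = 1"
  using norm_szego_sq[of 0] by (simp add: abs_square_eq_1)

lemma cmod_ev_le: "cmod z < 1 \<Longrightarrow> cmod (ev a z) \<le> norm a * norm (szego z)"
  using cmod_cinner_le[of a "szego z"] by (simp add: cinner_szego)

lift_definition dilate :: "real \<Rightarrow> h2 \<Rightarrow> h2" is
  "\<lambda>r a k. if \<bar>r\<bar> \<le> 1 then of_real r ^ k * a k else 0"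
proof -
  fix r :: real and a :: "nat \<Rightarrow> complex"
  assume a: "summable (\<lambda>k. (cmod (a k))\<^sup>2)"
  have "summable (\<lambda>k. (\<bar>r\<bar> ^ k * cmod (a k))\<^sup>2)" if "\<bar>r\<bar> \<le> 1"
  proof (rule summable_comparison_test'[OF a])
    show "norm ((\<bar>r\<bar> ^ k * cmod (a k))\<^sup>2) \<le> (cmod (a k))\<^sup>2" for k
      using that by (auto simp: power_mult_distrib intro!: mult_left_le_one_le power_le_one)
  qed
  then show "summable (\<lambda>k. (cmod (if \<bar>r\<bar> \<le> 1 then of_real r ^ k * a k else 0))\<^sup>2)"
    by (cases "\<bar>r\<bar> \<le> 1") (simp_all add: norm_mult norm_power)
qed

lemma coef_dilate: "\<bar>r\<bar> \<le> 1 \<Longrightarrow> coef (dilate r a) k = of_real r ^ k * coef a k"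
  by (simp add: dilate.rep_eq)

lemma norm_dilate_le:
  assumes "\<bar>r\<bar> \<le> 1" shows "norm (dilate r a) \<le> norm a"
proof -
  have "(norm (dilate r a))\<^sup>2 \<le> (norm a)\<^sup>2"
  proof (rule sums_le[OF _ norm_h2_sq_sums norm_h2_sq_sums])
    show "(cmod (coef (dilate r a) k))\<^sup>2 \<le> (cmod (coef a k))\<^sup>2" for k
      using assms by (auto simp: coef_dilate norm_mult norm_power
          intro!: power_mono mult_left_le_one_le power_le_one)
  qed
  then show ?thesis by (rule power2_le_imp_le) simp
qed

lemma eventually_unit_interval: "\<forall>\<^sub>F r in at_left 1. r \<in> {0<..<1::real}"
  by (rule eventually_at_leftI[of 0]) auto

lemma cmod_of_real_power_minus_1_le:
  assumes "0 \<le> r" "r \<le> 1" shows "cmod (of_real r ^ k - 1) \<le> 1"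
proof -
  have "cmod (of_real r ^ k - 1) = \<bar>r ^ k - 1\<bar>"
    by (metis norm_of_real of_real_1 of_real_diff of_real_power)
  also have "\<dots> \<le> 1"
    using assms by (simp add: power_le_one)
  finally show ?thesis .
qed

lemma tendsto_dilate: "((\<lambda>r. dilate r a) \<longlongrightarrow> a) (at_left 1)"
proof -
  define d where "d k r = (cmod ((of_real r ^ k - 1) * coef a k))\<^sup>2" for k and r :: real
  have "((\<lambda>r. \<Sum>k. d k r) \<longlongrightarrow> (\<Sum>k. 0)) (at_left 1)"
  proof (rule tannerys_theorem[THEN conjunct2, THEN conjunct2])
    show "(d k \<longlongrightarrow> 0) (at_left 1)" for k
    proof -
      have "(d k \<longlongrightarrow> (cmod ((of_real 1 ^ k - 1) * coef a k))\<^sup>2) (at_left 1)"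
        unfolding d_def by (intro tendsto_intros)
      then show ?thesis by simp
    qed
    have "norm (d k r) \<le> (cmod (coef a k))\<^sup>2" if "r \<in> {0<..<1}" for k r
      unfolding d_def norm_mult using cmod_of_real_power_minus_1_le[of r k] that
      by (auto intro!: power_mono mult_left_le_one_le)
    then show "\<forall>\<^sub>F (k, r) in at_top \<times>\<^sub>F at_left 1. norm (d k r) \<le> (cmod (coef a k))\<^sup>2"
      unfolding eventually_prod_filter using eventually_unit_interval
      by (intro exI[of _ "\<lambda>_. True"] exI[of _ "\<lambda>r. r \<in> {0<..<1}"]) simp
  qed (simp_all add: summable_coef)
  moreover have "\<forall>\<^sub>F r in at_left 1. (\<Sum>k. d k r) = (norm (dilate r a - a))\<^sup>2"
    using eventually_unit_interval
  proof eventually_elim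
    case (elim r)
    then show ?case
      unfolding sums_unique[OF norm_h2_sq_sums] by (simp add: d_def coef_dilate left_diff_distrib)
  qed
  ultimately have "((\<lambda>r. (norm (dilate r a - a))\<^sup>2) \<longlongrightarrow> 0) (at_left 1)"
    by (simp add: tendsto_cong)
  then have "((\<lambda>r. sqrt ((norm (dilate r a - a))\<^sup>2)) \<longlongrightarrow> sqrt 0) (at_left 1)"
    by (rule tendsto_real_sqrt)
  then have "((\<lambda>r. norm (dilate r a - a)) \<longlongrightarrow> 0) (at_left 1)"
    by simp
  then show ?thesis
    by (rule LIM_zero_cancel[OF tendsto_norm_zero_cancel])
qed

section \<open>Means over circles\<close>

lemma set_integrable_continuous_mult:
  fixes g h :: "real \<Rightarrow> complex"
  assumes h: "continuous_on {p..q} h" and g: "set_integrable lborel {p..q} g"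
  shows "set_integrable lborel {p..q} (\<lambda>t. h t * g t)"
proof -
  obtain C where C: "\<And>t. t \<in> {p..q} \<Longrightarrow> cmod (h t) \<le> C"
    using compact_imp_bounded[OF compact_continuous_image[OF h compact_Icc]]
    unfolding bounded_iff by fastforce
  show ?thesis
    unfolding set_integrable_def
  proof (rule Bochner_Integration.integrable_bound)
    show "integrable lborel (\<lambda>t. of_real C * (indicator {p..q} t *\<^sub>R g t))"
      using g unfolding set_integrable_def by (rule integrable_mult_right)
    have "(\<lambda>t. indicator {p..q} t *\<^sub>R h t) \<in> borel_measurable lborel"
      using borel_measurable_continuous_on_indicator[OF _ h] by simp
    moreover have "(\<lambda>t. indicator {p..q} t *\<^sub>R g t) \<in> borel_measurable lborel"
      using g unfolding set_integrable_def by (rule borel_measurable_integrable)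
    ultimately have
      "(\<lambda>t. (indicator {p..q} t *\<^sub>R h t) * (indicator {p..q} t *\<^sub>R g t)) \<in> borel_measurable lborel"
      by (rule borel_measurable_times)
    moreover have "(\<lambda>t. (indicator {p..q} t *\<^sub>R h t) * (indicator {p..q} t *\<^sub>R g t)) =
        (\<lambda>t. indicator {p..q} t *\<^sub>R (h t * g t))"
      by (auto simp: indicator_def)
    ultimately show "(\<lambda>t. indicator {p..q} t *\<^sub>R (h t * g t)) \<in> borel_measurable lborel"
      by (simp only:)
    show "AE t in lborel. norm (indicator {p..q} t *\<^sub>R (h t * g t))
        \<le> norm (of_real C * (indicator {p..q} t *\<^sub>R g t))"
      using C by (intro AE_I2) (force simp: indicator_def norm_mult intro!: mult_right_mono)
  qed
qed

lemma sums_set_integral_mult: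
  fixes c :: "nat \<Rightarrow> complex" and e :: "nat \<Rightarrow> real \<Rightarrow> complex"
  assumes g: "set_integrable lborel {p..q} g"
    and e: "\<And>k. continuous_on {p..q} (e k)" "\<And>k t. cmod (e k t) \<le> 1"
    and c: "summable (\<lambda>k. cmod (c k))" and s: "\<And>t. (\<lambda>k. c k * e k t) sums s t"
  shows "(\<lambda>k. c k * (LINT t:{p..q}|lborel. e k t * g t)) sums (LINT t:{p..q}|lborel. s t * g t)"
proof -
  define h where "h t = indicator {p..q} t *\<^sub>R g t" for t
  define f where "f k t = c k * (e k t * h t)" for k t
  have h: "integrable lborel h"
    using g by (simp add: set_integrable_def h_def[abs_def])
  have f: "f k = (\<lambda>t. c k * (indicator {p..q} t *\<^sub>R (e k t * g t)))" for k
    by (simp add: f_def h_def fun_eq_iff)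
  have int: "integrable lborel (f k)" for k
    using set_integrable_continuous_mult[OF e(1) g]
    unfolding set_integrable_def f by (rule integrable_mult_right)
  have norm_f_le: "norm (f k t) \<le> cmod (c k) * norm (h t)" for k t
  proof -
    have "cmod (e k t) * norm (h t) \<le> 1 * norm (h t)"
      by (intro mult_right_mono e) simp
    then show ?thesis
      by (simp add: f_def norm_mult mult_left_mono)
  qed
  have "(\<integral>t. norm (f k t) \<partial>lborel) \<le> cmod (c k) * (\<integral>t. norm (h t) \<partial>lborel)" for k
    unfolding integral_mult_right_zero[symmetric]
    by (intro integral_mono integrable_norm int integrable_mult_right h norm_f_le)
  then have "summable (\<lambda>k. \<integral>t. norm (f k t) \<partial>lborel)"
    by (intro summable_comparison_test'[OF summable_mult2[OF c]]) simp
  moreover have "summable (\<lambda>k. norm (f k t))" for t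
    by (rule summable_comparison_test'[OF summable_mult2[OF c]]) (use norm_f_le in simp)
  ultimately have "(\<lambda>k. integral\<^sup>L lborel (f k)) sums (\<integral>t. (\<Sum>k. f k t) \<partial>lborel)"
    by (intro sums_integral int) simp_all
  moreover have "(\<Sum>k. f k t) = indicator {p..q} t *\<^sub>R (s t * g t)" for t
    using sums_mult2[OF s[of t], of "h t"] by (simp add: f_def h_def sums_iff mult.assoc)
  moreover have "integral\<^sup>L lborel (f k) = c k * (LINT t:{p..q}|lborel. e k t * g t)" for k
    by (simp only: f set_lebesgue_integral_def integral_mult_right_zero)
  ultimately show ?thesis
    by (simp add: set_lebesgue_integral_def)
qed

lemma integral_cis_multiple:
  "(LINT t:{0..2*pi}|lborel. cis (of_int m * t)) = (if m = 0 then of_real (2 * pi) else 0)"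
proof (cases "m = 0")
  case True
  then show ?thesis by (simp add: set_lebesgue_integral_def scaleR_conv_of_real)
next
  case False
  have "(\<integral>t. indicator {0..2*pi} t *\<^sub>R cis (of_int m * t) \<partial>lborel) =
      cis (of_int m * (2 * pi)) / (\<i> * of_int m) - cis (of_int m * 0) / (\<i> * of_int m)"
  proof (rule integral_FTC_atLeastAtMost)
    fix t :: real
    have "((\<lambda>z. exp (\<i> * of_int m * z) / (\<i> * of_int m)) has_field_derivative
        exp (\<i> * of_int m * of_real t)) (at (of_real t))"
      using False by (auto intro!: derivative_eq_intros)
    from has_vector_derivative_real_field[OF this]
    show "((\<lambda>t. cis (of_int m * t) / (\<i> * of_int m)) has_vector_derivative
        cis (of_int m * t)) (at t within {0..2*pi})"
      by (simp add: cis_conv_exp mult.assoc)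
  qed (auto intro!: continuous_intros)
  moreover have "cis (of_int m * (2 * pi)) = 1"
    by (metis cis_multiple_2pi Ints_of_int mult.commute)
  ultimately show ?thesis
    using False by (simp add: set_lebesgue_integral_def)
qed

definition circle_mean :: "real \<Rightarrow> (complex \<Rightarrow> complex) \<Rightarrow> (real \<Rightarrow> complex) \<Rightarrow> complex" where
  "circle_mean r f g = (LINT t:{0..2*pi}|lborel. f (of_real r * cis t) * g t) / (2 * pi)"

definition circle_coeff :: "(real \<Rightarrow> complex) \<Rightarrow> nat \<Rightarrow> complex" where
  "circle_coeff g k = (LINT t:{0..2*pi}|lborel. cis (real k * t) * g t) / (2 * pi)"

lemma continuous_on_circle:
  assumes "f holomorphic_on ball 0 1" "0 \<le> r" "r < 1"
  shows "continuous_on S (\<lambda>t. f (of_real r * cis t))"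
  using holomorphic_on_imp_continuous_on[OF assms(1)]
  by (rule continuous_on_compose2) (use assms in \<open>auto intro!: continuous_intros simp: norm_mult\<close>)

lemma continuous_imp_L1_circle: "continuous_on {0..2*pi} g \<Longrightarrow> g \<in> L1_circle"
  by (simp add: L1_circle_def borel_integrable_atLeastAtMost')

lemma set_integrable_circle_mult:
  assumes "f holomorphic_on ball 0 1" "0 \<le> r" "r < 1" "g \<in> L1_circle"
  shows "set_integrable lborel {0..2*pi} (\<lambda>t. f (of_real r * cis t) * g t)"
  using assms
  by (intro set_integrable_continuous_mult continuous_on_circle) (simp_all add: L1_circle_def)

lemma summable_cmod_powser:
  fixes u :: "nat \<Rightarrow> complex"
  assumes "\<And>z. cmod z < 1 \<Longrightarrow> summable (\<lambda>k. u k * z ^ k)" "0 \<le> r" "r < 1"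
  shows "summable (\<lambda>k. cmod (u k) * r ^ k)"
proof -
  obtain R where "r < R" "R < 1"
    using dense assms(3) by blast
  then have "summable (\<lambda>k. norm (u k * of_real r ^ k))"
    using assms by (intro powser_insidea[of u "of_real R"]) simp_all
  then show ?thesis
    using assms(2) by (simp add: norm_mult norm_power)
qed

lemma circle_mean_sums:
  assumes f: "\<And>z. cmod z < 1 \<Longrightarrow> (\<lambda>k. u k * z ^ k) sums f z"
    and r: "0 \<le> r" "r < 1" and g: "g \<in> L1_circle"
  shows "(\<lambda>k. u k * of_real r ^ k * circle_coeff g k) sums circle_mean r f g"
proof -
  have "(\<lambda>k. (u k * of_real r ^ k) * (LINT t:{0..2*pi}|lborel. cis (real k * t) * g t)) sums
      (LINT t:{0..2*pi}|lborel. f (of_real r * cis t) * g t)"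
  proof (rule sums_set_integral_mult)
    have "summable (\<lambda>k. cmod (u k) * r ^ k)"
      using f r by (intro summable_cmod_powser) (auto simp: sums_iff)
    then show "summable (\<lambda>k. cmod (u k * of_real r ^ k))"
      using r by (simp add: norm_mult norm_power)
    show "(\<lambda>k. u k * of_real r ^ k * cis (real k * t)) sums f (of_real r * cis t)" for t
      using f[of "of_real r * cis t"] r
      by (simp add: norm_mult power_mult_distrib Complex.DeMoivre mult.assoc)
  qed (use g in \<open>auto simp: L1_circle_def intro!: continuous_intros\<close>)
  from sums_divide[OF this, of "of_real (2 * pi)"] show ?thesis
    unfolding circle_mean_def circle_coeff_def by (simp add: times_divide_eq_right)
qed

lemma circle_coeff_cis: "circle_coeff (\<lambda>t. cis (- (real k * t))) j = (if j = k then 1 else 0)"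
  using integral_cis_multiple[of "int j - int k"]
  by (simp add: circle_coeff_def cis_mult algebra_simps)

lemma circle_coeff_cnj_circle:
  assumes f: "\<And>z. cmod z < 1 \<Longrightarrow> (\<lambda>k. u k * z ^ k) sums f z" and r: "0 \<le> r" "r < 1"
  shows "circle_coeff (\<lambda>t. cnj (f (of_real r * cis t))) k = cnj (u k) * of_real r ^ k"
proof -
  have "(\<lambda>j. u j * of_real r ^ j * (if j = k then 1 else 0)) sums
      circle_mean r f (\<lambda>t. cis (- (real k * t)))"
    unfolding circle_coeff_cis[symmetric]
    by (intro circle_mean_sums f r continuous_imp_L1_circle continuous_intros)
  moreover have "(\<lambda>j. u j * of_real r ^ j * (if j = k then 1 else 0)) =
      (\<lambda>j. if j = k then u j * of_real r ^ j else 0)"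
    by auto
  ultimately have "circle_mean r f (\<lambda>t. cis (- (real k * t))) = u k * of_real r ^ k"
    using sums_unique2[OF _ sums_single[of k "\<lambda>j. u j * of_real r ^ j"]] by simp
  moreover have "circle_coeff (\<lambda>t. cnj (f (of_real r * cis t))) k =
      cnj (circle_mean r f (\<lambda>t. cis (- (real k * t))))"
  proof -
    have "(LINT t:{0..2*pi}|lborel. cis (real k * t) * cnj (f (of_real r * cis t))) =
        cnj (LINT t:{0..2*pi}|lborel. f (of_real r * cis t) * cis (- (real k * t)))"
      unfolding set_lebesgue_integral_def Bochner_Integration.integral_cnj[symmetric]
      by (simp add: cis_cnj mult.commute del: Bochner_Integration.integral_cnj)
    then show ?thesis
      by (simp add: circle_coeff_def circle_mean_def)
  qed
  ultimately show ?thesis by simp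
qed

lemma circle_mean_cnj_circle_sums:
  assumes f: "\<And>z. cmod z < 1 \<Longrightarrow> (\<lambda>k. u k * z ^ k) sums f z"
    and g: "\<And>z. cmod z < 1 \<Longrightarrow> (\<lambda>k. v k * z ^ k) sums g z" and r: "0 \<le> r" "r < 1"
  shows "(\<lambda>k. (u k * of_real r ^ k) * cnj (v k * of_real r ^ k)) sums
    circle_mean r f (\<lambda>t. cnj (g (of_real r * cis t)))"
proof -
  have "g holomorphic_on ball 0 1"
    using power_series_holomorphic[of 0 1 v g] g by simp
  then have "(\<lambda>t. cnj (g (of_real r * cis t))) \<in> L1_circle"
    by (intro continuous_imp_L1_circle continuous_on_cnj continuous_on_circle r)
  from circle_mean_sums[OF f r this] show ?thesis
    by (simp add: circle_coeff_cnj_circle[OF g r])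
qed

lemma circle_mean_ev:
  assumes r: "0 \<le> r" "r < 1"
  shows "circle_mean r (ev a) (\<lambda>t. cnj (ev b (of_real r * cis t))) =
    cinner (dilate r a) (dilate r b)"
  using circle_mean_cnj_circle_sums[OF ev_sums ev_sums r] r
    cinner_h2_sums[of "dilate r a" "dilate r b"]
  by (intro sums_unique2) (auto simp: coef_dilate mult.commute)

lemma h2_inner_ev: "h2_inner (ev a) (ev b) = cinner a b"
proof -
  have "((\<lambda>r. circle_mean r (ev a) (\<lambda>t. cnj (ev b (of_real r * cis t)))) \<longlongrightarrow> cinner a b)
      (at_left 1)"
  proof (rule Lim_transform_eventually)
    show "((\<lambda>r. cinner (dilate r a) (dilate r b)) \<longlongrightarrow> cinner a b) (at_left 1)"
      by (intro tendsto_intros tendsto_dilate)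
    show "\<forall>\<^sub>F r in at_left 1. cinner (dilate r a) (dilate r b) =
        circle_mean r (ev a) (\<lambda>t. cnj (ev b (of_real r * cis t)))"
      using eventually_unit_interval by eventually_elim (simp add: circle_mean_ev)
  qed
  then show ?thesis
    unfolding h2_inner_def circle_mean_def by (rule tendsto_Lim[rotated]) simp
qed

definition circle_msq :: "real \<Rightarrow> (complex \<Rightarrow> complex) \<Rightarrow> real" where
  "circle_msq r f = (LINT t:{0..2*pi}|lborel. (cmod (f (of_real r * cis t)))\<^sup>2) / (2 * pi)"

lemma circle_mean_self:
  "circle_mean r f (\<lambda>t. cnj (f (of_real r * cis t))) = of_real (circle_msq r f)"
  unfolding circle_mean_def circle_msq_def complex_norm_square[symmetric]
    set_integral_complex_of_real
  by simp

lemma circle_msq_sums: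
  assumes f: "\<And>z. cmod z < 1 \<Longrightarrow> (\<lambda>k. u k * z ^ k) sums f z" and r: "0 \<le> r" "r < 1"
  shows "(\<lambda>k. (cmod (u k) * r ^ k)\<^sup>2) sums circle_msq r f"
proof -
  have "(\<lambda>k. complex_of_real ((cmod (u k * of_real r ^ k))\<^sup>2)) sums of_real (circle_msq r f)"
    unfolding complex_norm_square circle_mean_self[symmetric]
    by (rule circle_mean_cnj_circle_sums[OF f f r])
  then show ?thesis
    unfolding sums_of_real_iff using r by (simp add: norm_mult norm_power)
qed

lemma circle_msq_ev: "0 \<le> r \<Longrightarrow> r < 1 \<Longrightarrow> circle_msq r (ev a) = (norm (dilate r a))\<^sup>2"
  using circle_mean_self[of r "ev a"] by (simp add: circle_mean_ev cinner_self del: of_real_power)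

lemma circle_msq_ev_le: "0 \<le> r \<Longrightarrow> r < 1 \<Longrightarrow> circle_msq r (ev a) \<le> (norm a)\<^sup>2"
  by (simp add: circle_msq_ev norm_dilate_le power_mono)

lemma tendsto_circle_msq_ev: "((\<lambda>r. circle_msq r (ev a)) \<longlongrightarrow> (norm a)\<^sup>2) (at_left 1)"
proof -
  have "((\<lambda>r. (norm (dilate r a))\<^sup>2) \<longlongrightarrow> (norm a)\<^sup>2) (at_left 1)"
    by (intro tendsto_intros tendsto_dilate)
  moreover have "\<forall>\<^sub>F r in at_left 1. (norm (dilate r a))\<^sup>2 = circle_msq r (ev a)"
    using eventually_unit_interval by eventually_elim (simp add: circle_msq_ev)
  ultimately show ?thesis
    by (rule Lim_transform_eventually)
qed

lemma sum_circle_msq: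
  assumes f: "\<And>i. i \<in> I \<Longrightarrow> f i holomorphic_on ball 0 1" and r: "0 \<le> r" "r < 1"
  shows "set_integrable lborel {0..2*pi} (\<lambda>t. \<Sum>i\<in>I. (cmod (f i (of_real r * cis t)))\<^sup>2)"
    and "(LINT t:{0..2*pi}|lborel. \<Sum>i\<in>I. (cmod (f i (of_real r * cis t)))\<^sup>2) / (2 * pi) =
      (\<Sum>i\<in>I. circle_msq r (f i))"
proof -
  have int: "integrable lborel (\<lambda>t. indicator {0..2*pi} t *\<^sub>R (cmod (f i (of_real r * cis t)))\<^sup>2)"
    if "i \<in> I" for i
    by (intro borel_integrable_compact continuous_intros compact_Icc
        continuous_on_circle[OF f[OF that] r])
  then show "set_integrable lborel {0..2*pi} (\<lambda>t. \<Sum>i\<in>I. (cmod (f i (of_real r * cis t)))\<^sup>2)"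
    unfolding set_integrable_def scaleR_sum_right by auto
  show "(LINT t:{0..2*pi}|lborel. \<Sum>i\<in>I. (cmod (f i (of_real r * cis t)))\<^sup>2) / (2 * pi) =
      (\<Sum>i\<in>I. circle_msq r (f i))"
    unfolding circle_msq_def sum_divide_distrib[symmetric] set_lebesgue_integral_def
      scaleR_sum_right
    by (simp only: Bochner_Integration.integral_sum[OF int])
qed

lemma sum_circle_msq_mono:
  assumes f: "\<And>i. i \<in> I \<Longrightarrow> f i holomorphic_on ball 0 1"
    and g: "\<And>j. j \<in> J \<Longrightarrow> g j holomorphic_on ball 0 1" and r: "0 \<le> r" "r < 1"
    and pointwise: "\<And>z. cmod z = r \<Longrightarrow> c * (\<Sum>i\<in>I. (cmod (f i z))\<^sup>2) \<le> (\<Sum>j\<in>J. (cmod (g j z))\<^sup>2)"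
  shows "c * (\<Sum>i\<in>I. circle_msq r (f i)) \<le> (\<Sum>j\<in>J. circle_msq r (g j))"
proof -
  have "c * ((LINT t:{0..2*pi}|lborel. \<Sum>i\<in>I. (cmod (f i (of_real r * cis t)))\<^sup>2) / (2 * pi))
      \<le> (LINT t:{0..2*pi}|lborel. \<Sum>j\<in>J. (cmod (g j (of_real r * cis t)))\<^sup>2) / (2 * pi)"
    unfolding times_divide_eq_right set_integral_mult_right[symmetric] using f g r
    by (intro divide_right_mono set_integral_mono set_integrable_mult_right sum_circle_msq(1)
        pointwise)
       (auto simp: norm_mult)
  then show ?thesis
    by (simp only: sum_circle_msq(2)[OF f r] sum_circle_msq(2)[OF g r])
qed

lemma circle_msq_mono:
  assumes "f holomorphic_on ball 0 1" "g holomorphic_on ball 0 1" "0 \<le> r" "r < 1"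
    and "\<And>z. cmod z = r \<Longrightarrow> cmod (f z) \<le> cmod (g z)"
  shows "circle_msq r f \<le> circle_msq r g"
  using sum_circle_msq_mono[of "{()}" "\<lambda>_. f" "{()}" "\<lambda>_. g" r 1] assms
  by (simp add: power_mono)

text \<open>The weight on the left tends to \<open>1\<close> at the boundary, so it is lost in the limit.\<close>

lemma sum_norm_sq_le_of_pointwise:
  assumes pointwise: "\<And>z. cmod z < 1 \<Longrightarrow>
    (1 - C * (1 - (cmod z)\<^sup>2)) * (\<Sum>i\<in>I. (cmod (ev (f i) z))\<^sup>2) \<le> (\<Sum>j\<in>J. (cmod (ev (g j) z))\<^sup>2)"
  shows "(\<Sum>i\<in>I. (norm (f i))\<^sup>2) \<le> (\<Sum>j\<in>J. (norm (g j))\<^sup>2)"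
proof (rule tendsto_le)
  show "((\<lambda>r. \<Sum>j\<in>J. circle_msq r (ev (g j))) \<longlongrightarrow> (\<Sum>j\<in>J. (norm (g j))\<^sup>2)) (at_left 1)"
    by (intro tendsto_sum tendsto_circle_msq_ev)
  have "((\<lambda>r. (1 - C * (1 - r\<^sup>2)) * (\<Sum>i\<in>I. circle_msq r (ev (f i)))) \<longlongrightarrow>
      (1 - C * (1 - 1\<^sup>2)) * (\<Sum>i\<in>I. (norm (f i))\<^sup>2)) (at_left 1)"
    by (intro tendsto_intros tendsto_circle_msq_ev)
  then show "((\<lambda>r. (1 - C * (1 - r\<^sup>2)) * (\<Sum>i\<in>I. circle_msq r (ev (f i)))) \<longlongrightarrow>
      (\<Sum>i\<in>I. (norm (f i))\<^sup>2)) (at_left 1)"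
    by simp
  show "\<forall>\<^sub>F r in at_left 1. (1 - C * (1 - r\<^sup>2)) * (\<Sum>i\<in>I. circle_msq r (ev (f i)))
      \<le> (\<Sum>j\<in>J. circle_msq r (ev (g j)))"
    using eventually_unit_interval
    by eventually_elim (rule sum_circle_msq_mono; use pointwise ev_holomorphic in auto)
qed simp

lemma norm_le_of_pointwise:
  assumes "\<And>z. cmod z < 1 \<Longrightarrow> (1 - C * (1 - (cmod z)\<^sup>2)) * (cmod (ev a z))\<^sup>2 \<le> (cmod (ev b z))\<^sup>2"
  shows "norm a \<le> norm b"
  using sum_norm_sq_le_of_pointwise[of C "\<lambda>_. a" "{()}" "\<lambda>_. b" "{()}"] assms by simp

lemma h2_of_holomorphic:
  assumes f: "f holomorphic_on ball 0 1" "\<And>z. \<not> cmod z < 1 \<Longrightarrow> f z = 0"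
    and C: "\<And>r. 0 \<le> r \<Longrightarrow> r < 1 \<Longrightarrow> circle_msq r f \<le> C\<^sup>2" "C \<ge> 0"
  obtains a where "ev a = f" "norm a \<le> C"
proof -
  define u where "u k = (deriv ^^ k) f 0 / fact k" for k
  have u: "(\<lambda>k. u k * z ^ k) sums f z" if "cmod z < 1" for z
    using holomorphic_power_series[OF f(1), of z] that by (simp add: u_def)
  have "(\<Sum>k<N. (cmod (u k))\<^sup>2) \<le> C\<^sup>2" for N
  proof (rule tendsto_upperbound)
    have "((\<lambda>r. \<Sum>k<N. (cmod (u k) * r ^ k)\<^sup>2) \<longlongrightarrow> (\<Sum>k<N. (cmod (u k) * 1 ^ k)\<^sup>2)) (at_left 1)"
      by (intro tendsto_intros)
    then show "((\<lambda>r. \<Sum>k<N. (cmod (u k) * r ^ k)\<^sup>2) \<longlongrightarrow> (\<Sum>k<N. (cmod (u k))\<^sup>2)) (at_left 1)"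
      by simp
    show "\<forall>\<^sub>F r in at_left 1. (\<Sum>k<N. (cmod (u k) * r ^ k)\<^sup>2) \<le> C\<^sup>2"
      using eventually_unit_interval
    proof eventually_elim
      case (elim r)
      then have s: "(\<lambda>k. (cmod (u k) * r ^ k)\<^sup>2) sums circle_msq r f"
        by (intro circle_msq_sums u) auto
      have "(\<Sum>k<N. (cmod (u k) * r ^ k)\<^sup>2) \<le> circle_msq r f"
        unfolding sums_unique[OF s] by (rule sum_le_suminf) (use s in \<open>auto simp: sums_iff\<close>)
      with C(1)[of r] elim show ?case by simp
    qed
  qed simp
  then obtain a where a: "coef a = u" "norm a \<le> C"
    using h2_of_bounded_partial_sums C(2) by blast
  have "ev a = f"
    by (rule ev_eqI) (use sums_unique2[OF ev_sums[of _ a]] u f(2) in \<open>auto simp: a(1)\<close>)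
  with a(2) that show ?thesis by blast
qed

section \<open>Bounded holomorphic functions and multipliers\<close>

definition bdd_hol :: "(complex \<Rightarrow> complex) \<Rightarrow> real \<Rightarrow> bool" where
  "bdd_hol f C \<longleftrightarrow> f holomorphic_on ball 0 1 \<and> (\<forall>z. cmod z < 1 \<longrightarrow> cmod (f z) \<le> C)"

lemma
  assumes "bdd_hol f C"
  shows bdd_hol_holomorphic: "f holomorphic_on ball 0 1"
    and bdd_hol_le: "cmod z < 1 \<Longrightarrow> cmod (f z) \<le> C" and bdd_hol_nonneg: "0 \<le> C"
  using assms order_trans[OF norm_ge_zero, of "f 0" C] by (auto simp: bdd_hol_def)

lemma bdd_hol_ev: "bdd_hol (ev a) C \<longleftrightarrow> (\<forall>z. cmod z < 1 \<longrightarrow> cmod (ev a z) \<le> C)"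
  by (simp add: bdd_hol_def ev_holomorphic)

lemma bdd_hol_mult: "bdd_hol f C \<Longrightarrow> bdd_hol g D \<Longrightarrow> bdd_hol (\<lambda>z. f z * g z) (C * D)"
  using bdd_hol_nonneg[of f C]
  by (auto simp: bdd_hol_def norm_mult intro!: holomorphic_intros mult_mono)

lemma bdd_hol_compose:
  assumes "bdd_hol f C" "g holomorphic_on ball 0 1" "\<And>z. cmod z < 1 \<Longrightarrow> cmod (g z) < 1"
  shows "bdd_hol (\<lambda>z. f (g z)) C"
  using assms unfolding bdd_hol_def
  by (auto intro!: holomorphic_on_compose_gen[of g _ f "ball 0 1", unfolded o_def])

lemma bdd_hol_poly: "\<exists>C. bdd_hol (poly p) C"
proof -
  have "bounded (poly p ` cball (0::complex) 1)"
    by (intro compact_imp_bounded compact_continuous_image compact_cball continuous_intros)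
  then obtain C where "\<forall>x\<in>poly p ` cball 0 1. cmod x \<le> C"
    unfolding bounded_iff by blast
  then have "bdd_hol (poly p) C"
    by (auto simp: bdd_hol_def intro!: holomorphic_intros)
  then show ?thesis by blast
qed

definition mul :: "(complex \<Rightarrow> complex) \<Rightarrow> h2 \<Rightarrow> h2" where
  "mul u a = inv ev (\<lambda>z. u z * ev a z)"

lemma mul_exists:
  assumes u: "bdd_hol u C"
  obtains b where "ev b = (\<lambda>z. u z * ev a z)" "norm b \<le> C * norm a"
proof (rule h2_of_holomorphic[of "\<lambda>z. u z * ev a z" "C * norm a"])
  show hol: "(\<lambda>z. u z * ev a z) holomorphic_on ball 0 1"
    by (intro holomorphic_intros bdd_hol_holomorphic[OF u] ev_holomorphic)
  fix r :: real assume r: "0 \<le> r" "r < 1"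
  have "circle_msq r (\<lambda>z. u z * ev a z) \<le> circle_msq r (ev (of_real C *\<^sub>C a))"
  proof (rule circle_msq_mono[OF hol ev_holomorphic r])
    fix z assume "cmod z = r"
    then show "cmod (u z * ev a z) \<le> cmod (ev (of_real C *\<^sub>C a) z)"
      using bdd_hol_le[OF u, of z] bdd_hol_nonneg[OF u] r by (simp add: norm_mult mult_right_mono)
  qed
  also have "\<dots> \<le> (C * norm a)\<^sup>2"
    using circle_msq_ev_le[OF r, of "of_real C *\<^sub>C a"] by (simp add: power_mult_distrib)
  finally show "circle_msq r (\<lambda>z. u z * ev a z) \<le> (C * norm a)\<^sup>2" .
qed (use that bdd_hol_nonneg[OF u] in auto)

lemma ev_mul:
  assumes "bdd_hol u C" shows "ev (mul u a) = (\<lambda>z. u z * ev a z)"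
proof -
  obtain b where "ev b = (\<lambda>z. u z * ev a z)"
    using mul_exists[OF assms] .
  then show ?thesis
    unfolding mul_def by (metis f_inv_into_f rangeI)
qed

lemma norm_mul_le:
  assumes "bdd_hol u C" shows "norm (mul u a) \<le> C * norm a"
proof -
  obtain b where b: "ev b = (\<lambda>z. u z * ev a z)" "norm b \<le> C * norm a"
    using mul_exists[OF assms] .
  then have "mul u a = b"
    using ev_mul[OF assms, of a] by (simp flip: ev_inject)
  with b(2) show ?thesis by simp
qed

lemma mul_eqI:
  assumes "bdd_hol u C" "\<And>z. cmod z < 1 \<Longrightarrow> u z * ev a z = ev b z" shows "mul u a = b"
proof -
  have "ev (mul u a) = ev b"
    using assms(2) by (intro ev_eqI) (simp_all add: ev_mul[OF assms(1)])
  then show ?thesis by (simp add: ev_inject)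
qed

lemma mul_add: "bdd_hol u C \<Longrightarrow> mul u (a + b) = mul u a + mul u b"
  by (rule mul_eqI) (simp_all add: ev_mul distrib_left)

lemma mul_scaleC: "bdd_hol u C \<Longrightarrow> mul u (c *\<^sub>C a) = c *\<^sub>C mul u a"
  by (rule mul_eqI) (simp_all add: ev_mul)

lemma norm_mul_isometry:
  assumes u: "bdd_hol u 1"
    and defect: "\<And>z. cmod z < 1 \<Longrightarrow> 1 - (cmod (u z))\<^sup>2 \<le> C * (1 - (cmod z)\<^sup>2)"
  shows "norm (mul u a) = norm a"
proof (rule antisym)
  show "norm (mul u a) \<le> norm a"
    using norm_mul_le[OF u, of a] by simp
  show "norm a \<le> norm (mul u a)"
  proof (rule norm_le_of_pointwise)
    fix z assume "cmod z < 1"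
    then have "1 - C * (1 - (cmod z)\<^sup>2) \<le> (cmod (u z))\<^sup>2"
      using defect[of z] by simp
    then show "(1 - C * (1 - (cmod z)\<^sup>2)) * (cmod (ev a z))\<^sup>2 \<le> (cmod (ev (mul u a) z))\<^sup>2"
      by (simp add: ev_mul[OF u] norm_mult power_mult_distrib mult_right_mono)
  qed
qed

lemma mul_szego_0: "bdd_hol (ev a) C \<Longrightarrow> mul (ev a) (szego 0) = a"
  by (rule mul_eqI) (simp_all add: ev_szego)

lemma norm_le_of_bdd_hol: "bdd_hol (ev a) C \<Longrightarrow> norm a \<le> C"
  using norm_mul_le[of "ev a" C "szego 0"] by (simp add: mul_szego_0)

lemma Hinf_iff: "f \<in> Hinf \<longleftrightarrow> (\<exists>C. bdd_hol f C) \<and> (\<forall>z. \<not> cmod z < 1 \<longrightarrow> f z = 0)"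
proof -
  have "bounded (f ` ball 0 1) \<longleftrightarrow> (\<exists>C. \<forall>z. cmod z < 1 \<longrightarrow> cmod (f z) \<le> C)"
    by (simp add: bounded_iff) (simp add: Ball_def)
  then show ?thesis
    by (auto simp: Hinf_def bdd_hol_def)
qed

lemma ev_mem_Hinf_iff: "ev a \<in> Hinf \<longleftrightarrow> (\<exists>C. bdd_hol (ev a) C)"
  by (simp add: Hinf_iff)

lemma Hinf_subset_range_ev: "Hinf \<subseteq> range ev"
proof
  fix f assume f: "f \<in> Hinf"
  then obtain C where "bdd_hol f C"
    by (auto simp: Hinf_iff)
  then have "ev (mul f (szego 0)) = f"
    using f by (intro ev_eqI) (auto simp: ev_mul ev_szego Hinf_iff)
  then show "f \<in> range ev" by (metis rangeI)
qed

lemma bdd_hol_cut: "bdd_hol f C \<Longrightarrow> (\<lambda>z. if cmod z < 1 then f z else 0) \<in> Hinf"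
  by (auto simp: Hinf_iff bdd_hol_def intro!: exI[of _ C] holomorphic_transform[of f])

lemma cmod_of_real_mult_less_1:
  "0 \<le> r \<Longrightarrow> r < 1 \<Longrightarrow> cmod z < 1 \<Longrightarrow> cmod (of_real r * z) < 1"
  using mult_strict_mono'[of r 1 "cmod z" 1] by (simp add: norm_mult)

lemma dilation_polynomial_approximation:
  assumes f: "f holomorphic_on ball 0 1" and r: "0 \<le> r" "r < 1" and "e > 0"
  obtains p :: "complex poly" where "\<And>z. cmod z < 1 \<Longrightarrow> cmod (poly p z - f (of_real r * z)) < e"
proof -
  define u where "u k = (deriv ^^ k) f 0 / fact k" for k
  have u: "(\<lambda>k. u k * z ^ k) sums f z" if "cmod z < 1" for z
    using holomorphic_power_series[OF f, of z] that by (simp add: u_def)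
  have "summable (\<lambda>k. cmod (u k) * r ^ k)"
    using u r by (intro summable_cmod_powser) (auto simp: sums_iff)
  moreover have "norm (u k * (of_real r * z) ^ k) \<le> cmod (u k) * r ^ k" if "cmod z < 1" for k z
  proof -
    have "r ^ k * cmod z ^ k \<le> r ^ k * 1"
      using r that by (intro mult_left_mono power_le_one) auto
    then show ?thesis
      using r by (simp add: norm_mult norm_power power_mult_distrib mult_left_mono)
  qed
  ultimately have "uniform_limit (ball 0 1) (\<lambda>N z. \<Sum>k<N. u k * (of_real r * z) ^ k)
      (\<lambda>z. \<Sum>k. u k * (of_real r * z) ^ k) sequentially"
    by (intro Weierstrass_m_test) auto
  then have "\<forall>\<^sub>F N in sequentially. \<forall>z\<in>ball 0 1.
      dist (\<Sum>k<N. u k * (of_real r * z) ^ k) (\<Sum>k. u k * (of_real r * z) ^ k) < e"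
    using \<open>e > 0\<close> by (rule uniform_limitD)
  then obtain N where N: "\<forall>z\<in>ball 0 1.
      dist (\<Sum>k<N. u k * (of_real r * z) ^ k) (\<Sum>k. u k * (of_real r * z) ^ k) < e"
    using eventually_happens'[OF sequentially_bot] by blast
  show thesis
  proof (rule that[of "\<Sum>k<N. monom (u k * of_real r ^ k) k"])
    fix z assume z: "cmod z < 1"
    then have "(\<Sum>k. u k * (of_real r * z) ^ k) = f (of_real r * z)"
      using sums_unique[OF u[OF cmod_of_real_mult_less_1]] r by simp
    then show "cmod (poly (\<Sum>k<N. monom (u k * of_real r ^ k) k) z - f (of_real r * z)) < e"
      using N[rule_format, of z] z
      by (simp add: poly_sum poly_monom dist_norm power_mult_distrib mult.assoc)
  qed
qed

lemma tendsto_dilation: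
  assumes f: "f holomorphic_on ball 0 1" and "cmod z < 1" and "(r \<longlongrightarrow> 1) F"
  shows "((\<lambda>n. f (of_real (r n) * z)) \<longlongrightarrow> f z) F"
proof -
  have "((\<lambda>n. of_real (r n) * z) \<longlongrightarrow> of_real 1 * z) F"
    by (intro tendsto_intros assms)
  moreover have "isCont f z"
    using holomorphic_on_imp_continuous_on[OF f] \<open>cmod z < 1\<close>
    by (simp add: continuous_on_eq_continuous_at)
  ultimately show ?thesis
    by (intro isCont_tendsto_compose[of z f]) simp_all
qed

lemma bdd_hol_polynomial_approximation:
  assumes f: "bdd_hol f C"
  obtains p :: "nat \<Rightarrow> complex poly"
  where "\<And>n. bdd_hol (poly (p n)) (C + 1)" "\<And>z. cmod z < 1 \<Longrightarrow> (\<lambda>n. poly (p n) z) \<longlonglongrightarrow> f z"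
proof -
  define d where "d n = inverse (real (Suc n))" for n
  define r where "r n = 1 - d n" for n
  have d: "0 < d n" "d n \<le> 1" for n
    by (simp_all add: d_def inverse_le_1_iff)
  then have r: "0 \<le> r n" "r n < 1" for n
    by (simp_all add: r_def)
  have "\<exists>p :: complex poly. \<forall>z. cmod z < 1 \<longrightarrow> cmod (poly p z - f (of_real (r n) * z)) < d n" for n
    using dilation_polynomial_approximation[OF bdd_hol_holomorphic[OF f] r d(1)] by metis
  then obtain p :: "nat \<Rightarrow> complex poly" where
    p: "\<And>n z. cmod z < 1 \<Longrightarrow> cmod (poly (p n) z - f (of_real (r n) * z)) < d n"
    by metis
  show thesis
  proof (rule that[of p])
    have "cmod (poly (p n) z) \<le> C + 1" if z: "cmod z < 1" for n z
      using norm_triangle_sub[of "poly (p n) z" "f (of_real (r n) * z)"] p[OF z, of n] d(2)[of n]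
        bdd_hol_le[OF f cmod_of_real_mult_less_1[OF r z], of n] by linarith
    then show "bdd_hol (poly (p n)) (C + 1)" for n
      by (auto simp: bdd_hol_def intro!: holomorphic_intros)
  next
    fix z :: complex assume z: "cmod z < 1"
    have "r \<longlonglongrightarrow> 1"
      using LIMSEQ_inverse_real_of_nat_add_minus[of 1] by (simp add: r_def[abs_def] d_def)
    then have "(\<lambda>n. f (of_real (r n) * z)) \<longlonglongrightarrow> f z"
      by (rule tendsto_dilation[OF bdd_hol_holomorphic[OF f] z])
    moreover have "(\<lambda>n. poly (p n) z - f (of_real (r n) * z)) \<longlonglongrightarrow> 0"
    proof (rule Lim_null_comparison)
      show "d \<longlonglongrightarrow> 0"
        unfolding d_def by (rule LIMSEQ_inverse_real_of_nat)
      show "\<forall>\<^sub>F n in sequentially. norm (poly (p n) z - f (of_real (r n) * z)) \<le> d n"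
        using p[OF z] by (auto intro!: always_eventually less_imp_le)
    qed
    ultimately show "(\<lambda>n. poly (p n) z) \<longlonglongrightarrow> f z"
      using tendsto_add by fastforce
  qed
qed

section \<open>Bounded pointwise convergence implies weak-star convergence\<close>

lemma circle_mean_le:
  assumes f: "bdd_hol f C" and r: "0 \<le> r" "r < 1" and g: "g \<in> L1_circle"
  shows "cmod (circle_mean r f g) \<le> C * ((LINT t:{0..2*pi}|lborel. cmod (g t)) / (2 * pi))"
proof -
  have int: "set_integrable lborel {0..2*pi} (\<lambda>t. f (of_real r * cis t) * g t)"
    by (rule set_integrable_circle_mult[OF bdd_hol_holomorphic[OF f] r g])
  have "cmod (LINT t:{0..2*pi}|lborel. f (of_real r * cis t) * g t)
      \<le> (LINT t:{0..2*pi}|lborel. cmod (f (of_real r * cis t) * g t))"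
    by (rule set_integral_norm_bound[OF int])
  also have "\<dots> \<le> (LINT t:{0..2*pi}|lborel. C * cmod (g t))"
  proof (rule set_integral_mono)
    show "set_integrable lborel {0..2*pi} (\<lambda>t. C * cmod (g t))"
      using g by (intro set_integrable_mult_right set_integrable_norm) (simp add: L1_circle_def)
    show "cmod (f (of_real r * cis t) * g t) \<le> C * cmod (g t)" for t
      using bdd_hol_le[OF f] r by (auto simp: norm_mult intro!: mult_right_mono)
  qed (rule set_integrable_norm[OF int])
  finally show ?thesis
    by (simp add: circle_mean_def norm_divide divide_right_mono)
qed

lemma circle_mean_diff_right:
  assumes "f holomorphic_on ball 0 1" "0 \<le> r" "r < 1" "g \<in> L1_circle" "h \<in> L1_circle"
  shows "circle_mean r f (\<lambda>t. g t - h t) = circle_mean r f g - circle_mean r f h"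
  using assms
  by (simp add: circle_mean_def right_diff_distrib diff_divide_distrib set_integrable_circle_mult)

lemma cmod_circle_mean_le_circle_msq:
  assumes f: "f holomorphic_on ball 0 1" and r: "0 \<le> r" "r < 1"
    and g: "g \<in> L1_circle" "\<And>t. cmod (g t) \<le> K"
  shows "2 * cmod (circle_mean r f g) \<le> circle_msq r f + K\<^sup>2"
proof -
  have int: "set_integrable lborel {0..2*pi} (\<lambda>t. f (of_real r * cis t) * g t)"
    by (rule set_integrable_circle_mult[OF f r g(1)])
  have msq: "set_integrable lborel {0..2*pi} (\<lambda>t. (cmod (f (of_real r * cis t)))\<^sup>2)"
    by (intro borel_integrable_atLeastAtMost' continuous_intros continuous_on_circle[OF f r])
  have const: "set_integrable lborel {0..2*pi} (\<lambda>t. K\<^sup>2)"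
    by (intro borel_integrable_atLeastAtMost' continuous_intros)
  have "2 * cmod (LINT t:{0..2*pi}|lborel. f (of_real r * cis t) * g t)
      \<le> (LINT t:{0..2*pi}|lborel. 2 * cmod (f (of_real r * cis t) * g t))"
    using set_integral_norm_bound[OF int] by simp
  also have "\<dots> \<le> (LINT t:{0..2*pi}|lborel. (cmod (f (of_real r * cis t)))\<^sup>2 + K\<^sup>2)"
  proof (intro set_integral_mono set_integral_add msq const)
    show "set_integrable lborel {0..2*pi} (\<lambda>t. 2 * cmod (f (of_real r * cis t) * g t))"
      using set_integrable_norm[OF int] by simp
    fix t
    have "2 * cmod (f (of_real r * cis t)) * cmod (g t)
        \<le> (cmod (f (of_real r * cis t)))\<^sup>2 + (cmod (g t))\<^sup>2"
      by (rule sum_squares_bound)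
    also have "(cmod (g t))\<^sup>2 \<le> K\<^sup>2"
      by (intro power_mono g) simp
    finally show "2 * cmod (f (of_real r * cis t) * g t) \<le> (cmod (f (of_real r * cis t)))\<^sup>2 + K\<^sup>2"
      by (simp add: norm_mult)
  qed
  also have "\<dots> = 2 * pi * (circle_msq r f + K\<^sup>2)"
    by (simp add: set_integral_add(2)[OF msq const] circle_msq_def distrib_left)
       (simp add: set_lebesgue_integral_def)
  finally show ?thesis
    by (simp add: circle_mean_def norm_divide norm_mult field_simps)
qed

text \<open>
  Pair \<open>g\<close> with \<open>\<Sum>k<N. cnj (circle_coeff g k) * z ^ k\<close>, whose norm squared is the left-hand side.
\<close>

lemma sum_circle_coeff_sq_le:
  assumes g: "g \<in> L1_circle" "\<And>t. cmod (g t) \<le> K"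
  shows "(\<Sum>k<N. (cmod (circle_coeff g k))\<^sup>2) \<le> K\<^sup>2"
proof -
  define c where "c = circle_coeff g"
  define S where "S = (\<Sum>k<N. (cmod (c k))\<^sup>2)"
  define p where "p = Abs_h2 (\<lambda>k. if k < N then cnj (c k) else 0)"
  have coef_p: "coef p = (\<lambda>k. if k < N then cnj (c k) else 0)"
    unfolding p_def by (intro coef_Abs_h2 summable_finite[of "{..<N}"]) auto
  have "(\<lambda>k. (cmod (coef p k))\<^sup>2) sums (\<Sum>k<N. (cmod (coef p k))\<^sup>2)"
    by (rule sums_finite) (auto simp: coef_p)
  then have norm_p: "(norm p)\<^sup>2 = S"
    using sums_unique2[OF norm_h2_sq_sums] by (simp add: S_def coef_p)
  have dilated: "(\<Sum>k<N. (cmod (c k))\<^sup>2 * r ^ k) \<le> (S + K\<^sup>2) / 2" if r: "0 \<le> r" "r < 1" for r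
  proof -
    have "(\<lambda>k. coef p k * of_real r ^ k * c k) sums (\<Sum>k<N. coef p k * of_real r ^ k * c k)"
      by (rule sums_finite) (auto simp: coef_p)
    then have "circle_mean r (ev p) g = (\<Sum>k<N. coef p k * of_real r ^ k * c k)"
      using sums_unique2[OF circle_mean_sums[OF ev_sums r g(1)]] by (simp add: c_def)
    also have "\<dots> = of_real (\<Sum>k<N. (cmod (c k))\<^sup>2 * r ^ k)"
      by (simp add: coef_p of_real_cmod_sq mult_ac)
    finally have "(\<Sum>k<N. (cmod (c k))\<^sup>2 * r ^ k) \<le> cmod (circle_mean r (ev p) g)"
      by (metis complex_Re_le_cmod Re_complex_of_real)
    then show ?thesis
      using cmod_circle_mean_le_circle_msq[OF ev_holomorphic r g, of p] circle_msq_ev_le[OF r, of p]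
      by (simp add: norm_p)
  qed
  have "S \<le> (S + K\<^sup>2) / 2"
  proof (rule tendsto_upperbound)
    have "((\<lambda>r. \<Sum>k<N. (cmod (c k))\<^sup>2 * r ^ k) \<longlongrightarrow> (\<Sum>k<N. (cmod (c k))\<^sup>2 * 1 ^ k)) (at_left 1)"
      by (intro tendsto_intros)
    then show "((\<lambda>r. \<Sum>k<N. (cmod (c k))\<^sup>2 * r ^ k) \<longlongrightarrow> S) (at_left 1)"
      by (simp add: S_def)
    show "\<forall>\<^sub>F r in at_left 1. (\<Sum>k<N. (cmod (c k))\<^sup>2 * r ^ k) \<le> (S + K\<^sup>2) / 2"
      using eventually_unit_interval by eventually_elim (rule dilated; simp)
  qed simp
  then show ?thesis
    by (simp add: S_def c_def)
qed

lemma bounded_circle_mean_eq_cinner: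
  assumes g: "g \<in> L1_circle" "\<And>t. cmod (g t) \<le> K"
  obtains b where "\<And>a r. 0 \<le> r \<Longrightarrow> r < 1 \<Longrightarrow> circle_mean r (ev a) g = cinner (dilate r a) b"
proof -
  have "K \<ge> 0"
    using order_trans[OF norm_ge_zero g(2)] .
  then obtain b where b: "coef b = (\<lambda>k. cnj (circle_coeff g k))"
    using h2_of_bounded_partial_sums[of "\<lambda>k. cnj (circle_coeff g k)" K] sum_circle_coeff_sq_le[OF g]
    by (metis (no_types, lifting) complex_mod_cnj sum.cong)
  have "circle_mean r (ev a) g = cinner (dilate r a) b" if r: "0 \<le> r" "r < 1" for a r
    using circle_mean_sums[OF ev_sums r g(1), of a] cinner_h2_sums[of "dilate r a" b] r
    by (intro sums_unique2) (auto simp: coef_dilate b mult.commute)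
  with that show ?thesis by blast
qed

lemma wpair_eq_lim_circle_mean: "wpair f g = Lim (at_left 1) (\<lambda>r. circle_mean r f g)"
  by (simp add: wpair_def circle_mean_def)

lemma bounded_wpair_eq_cinner:
  assumes g: "g \<in> L1_circle" "\<And>t. cmod (g t) \<le> K"
  obtains b where "\<And>a. ((\<lambda>r. circle_mean r (ev a) g) \<longlongrightarrow> cinner a b) (at_left 1)"
    "\<And>a. wpair (ev a) g = cinner a b"
proof -
  obtain b where b: "\<And>a r. 0 \<le> r \<Longrightarrow> r < 1 \<Longrightarrow> circle_mean r (ev a) g = cinner (dilate r a) b"
    using bounded_circle_mean_eq_cinner[OF g] by blast
  have lim: "((\<lambda>r. circle_mean r (ev a) g) \<longlongrightarrow> cinner a b) (at_left 1)" for a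
  proof (rule Lim_transform_eventually)
    show "((\<lambda>r. cinner (dilate r a) b) \<longlongrightarrow> cinner a b) (at_left 1)"
      by (intro tendsto_intros tendsto_dilate)
    show "\<forall>\<^sub>F r in at_left 1. cinner (dilate r a) b = circle_mean r (ev a) g"
      using eventually_unit_interval by eventually_elim (simp add: b)
  qed
  moreover have "wpair (ev a) g = cinner a b" for a
    unfolding wpair_eq_lim_circle_mean by (rule tendsto_Lim[OF _ lim]) simp
  ultimately show ?thesis
    using that by blast
qed

lemma L1_circle_diff: "g \<in> L1_circle \<Longrightarrow> h \<in> L1_circle \<Longrightarrow> (\<lambda>t. g t - h t) \<in> L1_circle"
  by (simp add: L1_circle_def)

definition circle_L1_dist :: "(real \<Rightarrow> complex) \<Rightarrow> (real \<Rightarrow> complex) \<Rightarrow> real" where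
  "circle_L1_dist g h = (LINT t:{0..2*pi}|lborel. cmod (g t - h t)) / (2 * pi)"

definition truncate_at :: "nat \<Rightarrow> (real \<Rightarrow> complex) \<Rightarrow> real \<Rightarrow> complex" where
  "truncate_at n g t = (if cmod (g t) \<le> real n then g t else 0)"

lemma cmod_truncate_at_le: "cmod (truncate_at n g t) \<le> real n"
  by (simp add: truncate_at_def)

lemma L1_circle_truncate_at:
  assumes "g \<in> L1_circle" shows "truncate_at n g \<in> L1_circle"
proof -
  define h where "h t = indicator {0..2*pi} t *\<^sub>R g t" for t
  have h: "integrable lborel h"
    using assms by (simp add: L1_circle_def set_integrable_def h_def[abs_def])
  have [measurable]: "h \<in> borel_measurable borel"
    using borel_measurable_integrable[OF h] by simp
  have restrict_h: "indicator {0..2*pi} t *\<^sub>R truncate_at n g t = (if cmod (h t) \<le> real n then h t else 0)"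
    for t
    by (simp add: truncate_at_def h_def indicator_def)
  show ?thesis
    unfolding L1_circle_def mem_Collect_eq set_integrable_def restrict_h
    by (rule Bochner_Integration.integrable_bound[OF h]) auto
qed

lemma tendsto_truncate_at_L1:
  assumes g: "g \<in> L1_circle" shows "(\<lambda>n. circle_L1_dist (truncate_at n g) g) \<longlonglongrightarrow> 0"
proof -
  define f where "f n t = indicator {0..2*pi} t *\<^sub>R cmod (truncate_at n g t - g t)" for n t
  have "(\<lambda>n. integral\<^sup>L lborel (f n)) \<longlonglongrightarrow> (\<integral>t. 0 \<partial>(lborel :: real measure))"
  proof (rule integral_dominated_convergence)
    show "integrable lborel (\<lambda>t. cmod (indicator {0..2*pi} t *\<^sub>R g t))"
      using g by (intro integrable_norm) (simp add: L1_circle_def set_integrable_def)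
    show "f n \<in> borel_measurable lborel" for n
      using set_integrable_norm[of lborel "{0..2*pi}" "\<lambda>t. truncate_at n g t - g t"]
        L1_circle_diff[OF L1_circle_truncate_at[OF g] g, of n]
      by (simp add: L1_circle_def set_integrable_def f_def[abs_def] borel_measurable_integrable)
    show "AE t in lborel. norm (f n t) \<le> cmod (indicator {0..2*pi} t *\<^sub>R g t)" for n
      by (simp add: f_def truncate_at_def)
    have "\<forall>\<^sub>F n in sequentially. f n t = 0" for t
    proof -
      obtain N where "cmod (g t) \<le> real N"
        using real_arch_simple by blast
      then show ?thesis
        by (intro eventually_mono[OF eventually_ge_at_top[of N]]) (auto simp: f_def truncate_at_def)
    qed
    then show "AE t in lborel. (\<lambda>n. f n t) \<longlonglongrightarrow> 0"
      by (intro AE_I2 tendsto_eventually)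
  qed simp
  from tendsto_divide[OF this tendsto_const, of "2 * pi"] show ?thesis
    by (simp add: circle_L1_dist_def set_lebesgue_integral_def f_def[abs_def])
qed

lemma Moore_Osgood:
  fixes f :: "nat \<Rightarrow> 'a \<Rightarrow> 'b::complete_space"
  assumes f: "\<And>n. (f n \<longlongrightarrow> g n) G" and uniform: "uniform_limit S f h sequentially"
    and S: "\<forall>\<^sub>F x in G. x \<in> S" and "G \<noteq> bot"
  obtains l where "g \<longlonglongrightarrow> l" "(h \<longlongrightarrow> l) G"
proof -
  have "Cauchy g"
    unfolding Cauchy_def
  proof (intro allI impI)
    fix e :: real assume "e > 0"
    then obtain N where N: "\<And>n x. n \<ge> N \<Longrightarrow> x \<in> S \<Longrightarrow> dist (f n x) (h x) < e / 3"
      using uniform_limitD[OF uniform, of "e / 3"] by (auto simp: eventually_sequentially)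
    have "dist (g m) (g n) < e" if "m \<ge> N" "n \<ge> N" for m n
    proof -
      have "dist (g m) (g n) \<le> 2 * (e / 3)"
      proof (rule tendsto_upperbound)
        show "((\<lambda>x. dist (f m x) (f n x)) \<longlongrightarrow> dist (g m) (g n)) G"
          by (intro tendsto_intros f)
        show "\<forall>\<^sub>F x in G. dist (f m x) (f n x) \<le> 2 * (e / 3)"
          using S
        proof eventually_elim
          case (elim x)
          then show ?case
            using dist_triangle2[of "f m x" "f n x" "h x"] N[of m x] N[of n x] that by simp
        qed
      qed fact
      with \<open>e > 0\<close> show ?thesis by simp
    qed
    then show "\<exists>N. \<forall>m\<ge>N. \<forall>n\<ge>N. dist (g m) (g n) < e" by blast
  qed
  then obtain l where "g \<longlonglongrightarrow> l"
    using Cauchy_convergent convergent_def by blast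
  moreover have "(h \<longlongrightarrow> l) G"
    by (rule swap_uniform_limit'[OF _ \<open>g \<longlonglongrightarrow> l\<close> uniform S]) (simp_all add: f)
  ultimately show ?thesis
    using that by blast
qed

lemma dist_circle_mean_le:
  assumes f: "bdd_hol f C" and r: "0 \<le> r" "r < 1" and "g \<in> L1_circle" "h \<in> L1_circle"
  shows "dist (circle_mean r f g) (circle_mean r f h) \<le> C * circle_L1_dist g h"
  using circle_mean_le[OF f r L1_circle_diff[OF assms(4,5)]]
  by (simp add: dist_norm circle_L1_dist_def
      circle_mean_diff_right[OF bdd_hol_holomorphic[OF f] r assms(4,5)])

lemma tendsto_wpair:
  assumes a: "bdd_hol (ev a) C" and g: "g \<in> L1_circle"
  shows "((\<lambda>r. circle_mean r (ev a) g) \<longlongrightarrow> wpair (ev a) g) (at_left 1)"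
proof -
  define s where "s n = truncate_at n g" for n
  have s: "s n \<in> L1_circle" "cmod (s n t) \<le> real n" for n t
    by (simp_all add: s_def L1_circle_truncate_at g cmod_truncate_at_le)
  have uniform: "uniform_limit {0<..<1} (\<lambda>n r. circle_mean r (ev a) (s n))
      (\<lambda>r. circle_mean r (ev a) g) sequentially"
  proof (rule uniform_limit_of_dist_le)
    show "dist (circle_mean r (ev a) (s n)) (circle_mean r (ev a) g) \<le> C * circle_L1_dist (s n) g"
      if "r \<in> {0<..<1}" for n r
      using that by (intro dist_circle_mean_le a s g) auto
    show "(\<lambda>n. C * circle_L1_dist (s n) g) \<longlonglongrightarrow> 0"
      unfolding s_def by (rule tendsto_mult_right_zero[OF tendsto_truncate_at_L1[OF g]])
  qed
  have "((\<lambda>r. circle_mean r (ev a) (s n)) \<longlongrightarrow> wpair (ev a) (s n)) (at_left 1)" for n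
    using bounded_wpair_eq_cinner[OF s] by metis
  from Moore_Osgood[OF this uniform eventually_unit_interval]
  obtain l where l: "((\<lambda>r. circle_mean r (ev a) g) \<longlongrightarrow> l) (at_left 1)"
    by (metis trivial_limit_at_left_real)
  then have "wpair (ev a) g = l"
    unfolding wpair_eq_lim_circle_mean by (intro tendsto_Lim) simp_all
  with l show ?thesis by simp
qed

lemma dist_wpair_le:
  assumes a: "bdd_hol (ev a) C" and "g \<in> L1_circle" "h \<in> L1_circle"
  shows "dist (wpair (ev a) g) (wpair (ev a) h) \<le> C * circle_L1_dist g h"
proof (rule tendsto_upperbound)
  show "((\<lambda>r. dist (circle_mean r (ev a) g) (circle_mean r (ev a) h)) \<longlongrightarrow>
      dist (wpair (ev a) g) (wpair (ev a) h)) (at_left 1)"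
    by (intro tendsto_dist tendsto_wpair[OF a] assms)
  show "\<forall>\<^sub>F r in at_left 1. dist (circle_mean r (ev a) g) (circle_mean r (ev a) h)
      \<le> C * circle_L1_dist g h"
    using eventually_unit_interval by eventually_elim (simp add: dist_circle_mean_le assms)
qed simp

lemma bdd_hol_ev_limit:
  assumes "\<And>n. bdd_hol (ev (a n)) C" "\<And>z. cmod z < 1 \<Longrightarrow> (\<lambda>n. ev (a n) z) \<longlonglongrightarrow> ev b z"
  shows "bdd_hol (ev b) C"
  unfolding bdd_hol_ev
proof (intro allI impI)
  fix z assume z: "cmod z < 1"
  show "cmod (ev b z) \<le> C"
    by (rule tendsto_upperbound[OF tendsto_norm[OF assms(2)[OF z]]])
       (use assms(1) z in \<open>simp_all add: bdd_hol_le\<close>)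
qed

lemma tendsto_wpair_of_pointwise:
  assumes a: "\<And>n. bdd_hol (ev (a n)) C"
    and lim: "\<And>z. cmod z < 1 \<Longrightarrow> (\<lambda>n. ev (a n) z) \<longlonglongrightarrow> ev b z" and g: "g \<in> L1_circle"
  shows "(\<lambda>n. wpair (ev (a n)) g) \<longlonglongrightarrow> wpair (ev b) g"
proof -
  define s where "s m = truncate_at m g" for m
  have s: "s m \<in> L1_circle" "cmod (s m t) \<le> real m" for m t
    by (simp_all add: s_def L1_circle_truncate_at g cmod_truncate_at_le)
  have dist_0: "(\<lambda>m. C * circle_L1_dist (s m) g) \<longlonglongrightarrow> 0"
    unfolding s_def by (rule tendsto_mult_right_zero[OF tendsto_truncate_at_L1[OF g]])
  have b: "bdd_hol (ev b) C"
    by (rule bdd_hol_ev_limit[OF a lim])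
  have truncated: "(\<lambda>n. wpair (ev (a n)) (s m)) \<longlonglongrightarrow> wpair (ev b) (s m)" for m
  proof -
    obtain y where y: "\<And>x. wpair (ev x) (s m) = cinner x y"
      using bounded_wpair_eq_cinner[OF s] by metis
    show ?thesis
      unfolding y by (rule tendsto_cinner_of_pointwise[OF norm_le_of_bdd_hol[OF a] lim])
  qed
  have uniform: "uniform_limit UNIV (\<lambda>m n. wpair (ev (a n)) (s m))
      (\<lambda>n. wpair (ev (a n)) g) sequentially"
    by (rule uniform_limit_of_dist_le[OF dist_wpair_le[OF a s(1) g] dist_0])
  have "(\<lambda>m. wpair (ev b) (s m)) \<longlonglongrightarrow> wpair (ev b) g"
    by (rule tendsto_dist_iff[THEN iffD2], rule Lim_null_comparison[OF _ dist_0])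
       (simp add: dist_wpair_le b s g)
  then show ?thesis
    by (rule swap_uniform_limit'[rotated, OF _ uniform]) (simp_all add: truncated)
qed

lemma weakstar_closed_pointwise_limit:
  assumes M: "weakstar_closed M" and a: "\<And>n. ev (a n) \<in> M" "\<And>n. bdd_hol (ev (a n)) C"
    and lim: "\<And>z. cmod z < 1 \<Longrightarrow> (\<lambda>n. ev (a n) z) \<longlonglongrightarrow> ev b z"
  shows "ev b \<in> M"
proof -
  have "\<exists>h\<in>M. \<forall>g\<in>G. cmod (wpair (ev b) g - wpair h g) < e"
    if "finite G" "G \<subseteq> L1_circle" "e > 0" for G e
  proof -
    have "\<forall>\<^sub>F n in sequentially. \<forall>g\<in>G. dist (wpair (ev (a n)) g) (wpair (ev b) g) < e"
      using that
      by (intro eventually_ball_finite ballI tendstoD tendsto_wpair_of_pointwise[OF a(2) lim]) auto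
    then obtain n where "\<forall>g\<in>G. dist (wpair (ev (a n)) g) (wpair (ev b) g) < e"
      using eventually_happens'[OF sequentially_bot] by blast
    then show ?thesis
      using a(1) by (auto simp: dist_norm norm_minus_commute intro!: bexI[of _ "ev (a n)"])
  qed
  moreover have "ev b \<in> Hinf"
    using bdd_hol_ev_limit[OF a(2) lim] by (auto simp: ev_mem_Hinf_iff)
  ultimately show ?thesis
    using M unfolding weakstar_closed_def by blast
qed

section \<open>The shift by an inner symbol\<close>

locale inner_symbol =
  fixes B :: "complex \<Rightarrow> complex" and C :: real
  assumes B_holomorphic: "B holomorphic_on ball 0 1"
    and B_lt_1: "cmod z < 1 \<Longrightarrow> cmod (B z) < 1"
    and B_defect: "cmod z < 1 \<Longrightarrow> 1 - (cmod (B z))\<^sup>2 \<le> C * (1 - (cmod z)\<^sup>2)"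
    and B_0: "B 0 = 0"
begin

lemma C_ge_1: "1 \<le> C"
  using B_defect[of 0] by (simp add: B_0)

lemma bdd_hol_B: "bdd_hol B 1"
  using B_holomorphic B_lt_1 by (auto simp: bdd_hol_def intro: less_imp_le)

lemma bdd_hol_compose_B: "bdd_hol F D \<Longrightarrow> bdd_hol (\<lambda>z. F (B z)) D"
  by (rule bdd_hol_compose[OF _ B_holomorphic B_lt_1])

lemma ev_mul_B [simp]: "ev (mul B a) z = B z * ev a z"
  by (simp add: ev_mul[OF bdd_hol_B])

sublocale complex_isometry "mul B"
proof
  show "norm (mul B a) = norm a" for a
    by (rule norm_mul_isometry[OF bdd_hol_B B_defect])
qed (rule mul_add[OF bdd_hol_B] mul_scaleC[OF bdd_hol_B])+

lemma ev_mul_B_pow: "ev ((mul B ^^ m) a) z = B z ^ m * ev a z"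
  by (induction m) simp_all

lemma adjoint_eigenvector_szego: "cmod z < 1 \<Longrightarrow> adjoint_eigenvector (mul B) (B z) (szego z)"
  by (simp add: adjoint_eigenvector_def cinner_szego)

lemma mem_range_mul_B_pow_imp_0:
  assumes "\<And>m. a \<in> range (mul B ^^ m)" shows "a = 0"
proof (rule szego_total)
  fix z assume z: "cmod z < 1"
  have "cmod (ev a z) \<le> cmod (B z) ^ m * (norm a * norm (szego z))" for m
  proof -
    obtain b where b: "a = (mul B ^^ m) b"
      using assms by blast
    then have "cmod (ev a z) = cmod (B z) ^ m * cmod (ev b z)"
      by (simp add: ev_mul_B_pow norm_mult norm_power)
    also have "\<dots> \<le> cmod (B z) ^ m * (norm a * norm (szego z))"
      using cmod_ev_le[OF z, of b] b by (simp add: mult_left_mono)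
    finally show ?thesis .
  qed
  moreover have "(\<lambda>m. cmod (B z) ^ m * (norm a * norm (szego z))) \<longlonglongrightarrow> 0"
    using B_lt_1[OF z] by (intro tendsto_mult_left_zero LIMSEQ_realpow_zero) auto
  ultimately have "cmod (ev a z) \<le> 0"
    by (intro tendsto_lowerbound[of _ 0]) auto
  then show "cinner a (szego z) = 0"
    by (simp add: cinner_szego z)
qed

lemma ev_resolvent:
  assumes w: "cmod w < 1" and z: "cmod z < 1"
  shows "ev (resolvent w a) z = ev a z / (1 - cnj w * B z)"
proof -
  have "ev (resolvent w a) z = ev a z + cnj w * (B z * ev (resolvent w a) z)"
    using arg_cong[OF resolvent_eq[OF w, of a], of "\<lambda>x. ev x z"] by simp
  then show ?thesis
    using one_minus_cnj_mult_nonzero[OF w B_lt_1[OF z]] by (simp add: field_simps)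
qed

lemma cmod_ev_sq_le_herglotz:
  assumes z: "cmod z < 1" shows "(cmod (ev a z))\<^sup>2 \<le> C * Re (herglotz a (B z))"
proof -
  have pos: "1 - (cmod z)\<^sup>2 > 0"
    using z by (simp add: abs_square_less_1)
  have "(cmod (ev a z))\<^sup>2 \<le> (1 - (cmod (B z))\<^sup>2) / (1 - (cmod z)\<^sup>2) * Re (herglotz a (B z))"
    using cmod_cinner_sq_le_herglotz[OF B_lt_1[OF z] adjoint_eigenvector_szego[OF z], of a]
    by (simp add: cinner_szego[OF z] norm_szego_sq[OF z])
  also have "\<dots> \<le> C * Re (herglotz a (B z))"
    using B_defect[OF z] pos
    by (intro mult_right_mono Re_herglotz_nonneg B_lt_1 z) (simp add: divide_le_eq)
  finally show ?thesis .
qed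

lemma herglotz_szego_0:
  assumes w: "cmod w < 1" shows "herglotz (szego 0) w = 1"
proof -
  have "cinner (resolvent w (szego 0)) (szego 0) = 1"
    by (simp add: cinner_szego ev_resolvent[OF w] B_0 ev_szego)
  then have "cinner (szego 0) (resolvent w (szego 0)) = 1"
    by (metis cinner_commute complex_cnj_one)
  then show ?thesis by (simp add: herglotz_def)
qed

lemma norm_resolvent_sq_le:
  assumes w: "cmod w < 1" and a: "bdd_hol (ev a) D"
  shows "(1 - (cmod w)\<^sup>2) * (norm (resolvent w a))\<^sup>2 \<le> D\<^sup>2"
proof -
  have "resolvent w a = mul (ev a) (resolvent w (szego 0))"
    by (rule mul_eqI[OF a, symmetric]) (simp add: ev_resolvent[OF w] ev_szego)
  then have "(norm (resolvent w a))\<^sup>2 \<le> (D * norm (resolvent w (szego 0)))\<^sup>2"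
    using norm_mul_le[OF a] by (simp add: power_mono)
  then have "(1 - (cmod w)\<^sup>2) * (norm (resolvent w a))\<^sup>2
      \<le> (1 - (cmod w)\<^sup>2) * (D * norm (resolvent w (szego 0)))\<^sup>2"
    using w by (intro mult_left_mono) (simp_all add: abs_square_le_1)
  also have "\<dots> = D\<^sup>2 * Re (herglotz (szego 0) w)"
    by (simp add: Re_herglotz[OF w] power_mult_distrib)
  finally show ?thesis
    by (simp add: herglotz_szego_0[OF w])
qed

definition damping :: "h2 \<Rightarrow> complex \<Rightarrow> complex" where
  "damping h w = 1 / (1 + herglotz h w)"

lemma one_plus_Re_herglotz_le:
  assumes "cmod w < 1"
  shows "1 + Re (herglotz h w) \<le> cmod (1 + herglotz h w)" "0 < cmod (1 + herglotz h w)"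
proof -
  show "1 + Re (herglotz h w) \<le> cmod (1 + herglotz h w)"
    using complex_Re_le_cmod[of "1 + herglotz h w"] by simp
  with Re_herglotz_nonneg[OF assms] show "0 < cmod (1 + herglotz h w)"
    by (smt (verit))
qed

lemma bdd_hol_damping: "bdd_hol (damping h) 1"
  unfolding bdd_hol_def
proof (intro conjI allI impI)
  have "1 + herglotz h w \<noteq> 0" if "cmod w < 1" for w
    using one_plus_Re_herglotz_le(2)[OF that, of h] by auto
  then show "damping h holomorphic_on ball 0 1"
    unfolding damping_def[abs_def] by (intro holomorphic_intros herglotz_holomorphic) auto
  show "cmod (damping h w) \<le> 1" if "cmod w < 1" for w
    using one_plus_Re_herglotz_le[OF that, of h] Re_herglotz_nonneg[OF that, of h]
    by (simp add: damping_def norm_divide divide_le_eq)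
qed

lemma bdd_hol_damping_mul: "bdd_hol (ev (mul (\<lambda>z. damping h (B z)) h)) C"
  unfolding bdd_hol_ev
proof (intro allI impI)
  fix z assume z: "cmod z < 1"
  define x where "x = cmod (ev h z)"
  have "2 * x \<le> 1 + x\<^sup>2"
    using sum_squares_bound[of 1 x] by simp
  moreover have "0 \<le> x"
    by (simp add: x_def)
  ultimately have "x \<le> 1 + x\<^sup>2" by linarith
  also have "\<dots> \<le> C * (1 + Re (herglotz h (B z)))"
    using cmod_ev_sq_le_herglotz[OF z, of h] C_ge_1 by (simp add: x_def distrib_left)
  also have "\<dots> \<le> C * cmod (1 + herglotz h (B z))"
    using one_plus_Re_herglotz_le(1)[OF B_lt_1[OF z]] C_ge_1 by (intro mult_left_mono) auto
  finally have "cmod (damping h (B z) * ev h z) \<le> C"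
    using one_plus_Re_herglotz_le(2)[OF B_lt_1[OF z], of h]
    by (simp add: damping_def norm_mult norm_divide divide_le_eq x_def)
  then show "cmod (ev (mul (\<lambda>z. damping h (B z)) h) z) \<le> C"
    by (simp add: ev_mul[OF bdd_hol_compose_B[OF bdd_hol_damping]])
qed

lemma tendsto_damping:
  assumes "cmod w < 1" "(h \<longlongrightarrow> 0) F" shows "((\<lambda>n. damping (h n) w) \<longlongrightarrow> 1) F"
proof -
  have "((\<lambda>n. damping (h n) w) \<longlongrightarrow> 1 / (1 + 0)) F"
    unfolding damping_def by (intro tendsto_intros tendsto_herglotz_zero assms) simp
  then show ?thesis by simp
qed

lemma mul_poly_B:
  "mul (\<lambda>z. poly 0 (B z)) a = 0"
  "mul (\<lambda>z. poly (pCons c p) (B z)) a = c *\<^sub>C a + mul B (mul (\<lambda>z. poly p (B z)) a)"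
proof -
  have bdd: "\<exists>D. bdd_hol (\<lambda>z. poly q (B z)) D" for q
    using bdd_hol_poly bdd_hol_compose_B by blast
  show "mul (\<lambda>z. poly 0 (B z)) a = 0"
    using bdd[of 0] by (auto intro: mul_eqI)
  obtain D E where "bdd_hol (\<lambda>z. poly p (B z)) D" "bdd_hol (\<lambda>z. poly (pCons c p) (B z)) E"
    using bdd by blast
  then show "mul (\<lambda>z. poly (pCons c p) (B z)) a = c *\<^sub>C a + mul B (mul (\<lambda>z. poly p (B z)) a)"
    by (intro mul_eqI[of _ E]) (simp_all add: ev_mul[of _ D] distrib_right mult.assoc)
qed

lemma tendsto_mul_compose_B:
  assumes p: "\<And>n. bdd_hol (p n) D" and F: "bdd_hol F D"
    and lim: "\<And>z. cmod z < 1 \<Longrightarrow> (\<lambda>n. p n z) \<longlonglongrightarrow> F z" and z: "cmod z < 1"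
  shows "(\<lambda>n. ev (mul (\<lambda>z. p n (B z)) a) z) \<longlonglongrightarrow> ev (mul (\<lambda>z. F (B z)) a) z"
  unfolding ev_mul[OF bdd_hol_compose_B[OF p]] ev_mul[OF bdd_hol_compose_B[OF F]]
  by (intro tendsto_intros lim B_lt_1 z)

lemma HinfB_iff:
  "G \<in> HinfB B \<longleftrightarrow> (\<exists>F D. bdd_hol F D \<and> G = (\<lambda>z. if cmod z < 1 then F (B z) else 0))"
proof
  assume "G \<in> HinfB B"
  then show "\<exists>F D. bdd_hol F D \<and> G = (\<lambda>z. if cmod z < 1 then F (B z) else 0)"
    by (auto simp: HinfB_def Hinf_iff)
next
  assume "\<exists>F D. bdd_hol F D \<and> G = (\<lambda>z. if cmod z < 1 then F (B z) else 0)"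
  then obtain F D where F: "bdd_hol F D" "G = (\<lambda>z. if cmod z < 1 then F (B z) else 0)" by blast
  have "G = (\<lambda>z. if z \<in> ball 0 1 then (if cmod (B z) < 1 then F (B z) else 0) else 0)"
    using B_lt_1 by (auto simp: F(2))
  with bdd_hol_cut[OF F(1)] show "G \<in> HinfB B"
    unfolding HinfB_def mem_Collect_eq by (intro exI conjI)
qed

lemma HinfB_combination:
  fixes r :: nat
  assumes "\<forall>i<r. F i \<in> HinfB B"
  obtains G D where "\<And>i. i < r \<Longrightarrow> bdd_hol (G i) (D i)"
    "\<And>i. i < r \<Longrightarrow> F i = (\<lambda>z. if cmod z < 1 then G i (B z) else 0)"
    "(\<lambda>z. \<Sum>i<r. ev (e i) z * F i z) = ev (\<Sum>i<r. mul (\<lambda>z. G i (B z)) (e i))"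
proof -
  obtain G D where G: "\<And>i. i < r \<Longrightarrow> bdd_hol (G i) (D i)"
    "\<And>i. i < r \<Longrightarrow> F i = (\<lambda>z. if cmod z < 1 then G i (B z) else 0)"
    using assms unfolding HinfB_iff by metis
  have "ev (mul (\<lambda>z. G i (B z)) (e i)) z = ev (e i) z * F i z" if "i < r" for i z
    unfolding ev_mul[OF bdd_hol_compose_B[OF G(1)[OF that]]] G(2)[OF that]
    by (cases "cmod z < 1") simp_all
  then have "(\<lambda>z. \<Sum>i<r. ev (e i) z * F i z) = ev (\<Sum>i<r. mul (\<lambda>z. G i (B z)) (e i))"
    by (simp add: fun_eq_iff ev_sum)
  with G that show ?thesis by blast
qed

end

locale symbol_invariant_subspace = inner_symbol B C + shift_invariant_subspace "mul B" K
  for B C K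
begin

lemma sum_cmod_ev_wandering_le:
  assumes e: "orthonormal_on I e" "e ` I \<subseteq> wandering" "finite I" and z: "cmod z < 1"
  shows "(\<Sum>i\<in>I. (cmod (ev (e i) z))\<^sup>2) \<le> (1 - (cmod (B z))\<^sup>2) / (1 - (cmod z)\<^sup>2)"
  using sum_wandering_adjoint_eigenvector_le[OF B_lt_1[OF z] adjoint_eigenvector_szego[OF z] e]
  by (simp add: cinner_szego[OF z] norm_szego_sq[OF z])

lemma bdd_hol_wandering:
  assumes e: "orthonormal_on I e" "e ` I \<subseteq> wandering" "i \<in> I" shows "bdd_hol (ev (e i)) (sqrt C)"
  unfolding bdd_hol_ev
proof (intro allI impI)
  fix z assume z: "cmod z < 1"
  have "(cmod (ev (e i) z))\<^sup>2 \<le> (1 - (cmod (B z))\<^sup>2) / (1 - (cmod z)\<^sup>2)"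
    using sum_cmod_ev_wandering_le[of "{i}" e z] e z
    by (simp add: orthonormal_on_def image_subset_iff)
  also have "\<dots> \<le> C"
    using B_defect[OF z] z by (simp add: divide_le_eq abs_square_less_1)
  finally show "cmod (ev (e i) z) \<le> sqrt C"
    by (rule real_le_rsqrt)
qed

lemma card_orthonormal_wandering_le:
  fixes r n :: nat
  assumes e: "orthonormal_on {..<r} e" "e ` {..<r} \<subseteq> wandering"
    and defect: "\<And>z. cmod z < 1 \<Longrightarrow>
      1 - (cmod (B z))\<^sup>2 \<le> (1 - (cmod z)\<^sup>2) * (\<Sum>j<n. (cmod (ev (k j) z))\<^sup>2)"
    and k: "\<And>j. j < n \<Longrightarrow> norm (k j) \<le> 1"
  shows "r \<le> n"
proof -
  have "(\<Sum>i<r. (norm (e i))\<^sup>2) \<le> (\<Sum>j<n. (norm (k j))\<^sup>2)"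
  proof (rule sum_norm_sq_le_of_pointwise[where C = 0])
    fix z assume z: "cmod z < 1"
    then have "(1 - (cmod (B z))\<^sup>2) / (1 - (cmod z)\<^sup>2) \<le> (\<Sum>j<n. (cmod (ev (k j) z))\<^sup>2)"
      using defect[OF z] by (simp add: divide_le_eq abs_square_less_1 mult.commute)
    then show "(1 - 0 * (1 - (cmod z)\<^sup>2)) * (\<Sum>i<r. (cmod (ev (e i) z))\<^sup>2)
        \<le> (\<Sum>j<n. (cmod (ev (k j) z))\<^sup>2)"
      using sum_cmod_ev_wandering_le[OF e _ z] by simp
  qed
  also have "\<dots> \<le> (\<Sum>j<n. 1)"
    using k by (intro sum_mono) (simp add: abs_square_le_1)
  finally show ?thesis
    using norm_orthonormal[OF e(1)] by simp
qed

lemma B_inner_wandering: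
  assumes e: "orthonormal_on I e" "e ` I \<subseteq> wandering" "i \<in> I" shows "B_inner B (ev (e i))"
  unfolding B_inner_def
proof (intro conjI allI)
  show "ev (e i) \<in> Hinf"
    using bdd_hol_wandering[OF e] by (auto simp: ev_mem_Hinf_iff)
  have "(\<lambda>z. B z ^ m * ev (e i) z) = ev ((mul B ^^ m) (e i))" for m
    by (simp add: fun_eq_iff ev_mul_B_pow)
  moreover have "e i \<in> wandering"
    using e by blast
  ultimately show "h2_inner (\<lambda>z. B z ^ m * ev (e i) z) (\<lambda>z. B z ^ k * ev (e i) z) =
      (if m = k then 1 else 0)" for m k
    by (simp add: h2_inner_ev cinner_T_pow_wandering orthonormal_onD[OF e(1)] e(3))
qed

lemma bdd_hol_cinner_resolvent:
  assumes a: "a \<in> K" "bdd_hol (ev a) D" and J: "J \<in> wandering" "norm J = 1"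
  shows "bdd_hol (\<lambda>w. cinner a (resolvent w J)) D"
  unfolding bdd_hol_def
proof (intro conjI allI impI cinner_resolvent_holomorphic)
  fix w assume w: "cmod w < 1"
  have "(cmod (cinner a (resolvent w J)))\<^sup>2 \<le> D\<^sup>2"
    using cmod_cinner_resolvent_wandering_sq_le[OF w a(1) J] norm_resolvent_sq_le[OF w a(2)]
    by linarith
  then show "cmod (cinner a (resolvent w J)) \<le> D"
    by (rule power2_le_imp_le[OF _ bdd_hol_nonneg[OF a(2)]])
qed

lemma ev_expansion:
  assumes e: "orthonormal_basis wandering r e" and "a \<in> K" and z: "cmod z < 1"
  shows "ev a z = (\<Sum>i<r. ev (e i) z * cinner a (resolvent (B z) (e i)))"
  using wandering_expansion[OF e \<open>a \<in> K\<close> B_lt_1[OF z] adjoint_eigenvector_szego[OF z]]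
  by (simp add: cinner_szego z)

lemma mul_poly_wandering:
  assumes w: "cmod w < 1" and I: "I \<in> wandering" and J: "J \<in> wandering"
  shows "mul (\<lambda>z. poly p (B z)) I \<in> K \<and>
    cinner (mul (\<lambda>z. poly p (B z)) I) (resolvent w J) = poly p w * cinner I J"
proof (induction p)
  case 0
  show ?case
    unfolding mul_poly_B using complex_vector.subspace_0[OF csubspace_K]
    by (simp add: cinner.zero_left)
next
  case (pCons c p)
  then show ?case
    unfolding mul_poly_B
    by (auto simp: cinner.add_left distrib_right cinner_T_resolvent_wandering[OF w _ J]
        cinner_wandering_resolvent_wandering[OF w I J] wandering_mem[OF I]
        intro!: complex_vector.subspace_add complex_vector.subspace_scale csubspace_K T_mem)
qed

lemma cinner_mul_resolvent:
  assumes F: "bdd_hol F D" and w: "cmod w < 1" and I: "I \<in> wandering" and J: "J \<in> wandering"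
  shows "cinner (mul (\<lambda>z. F (B z)) I) (resolvent w J) = F w * cinner I J"
proof -
  obtain p where p: "\<And>n. bdd_hol (poly (p n)) (D + 1)"
    "\<And>z. cmod z < 1 \<Longrightarrow> (\<lambda>n. poly (p n) z) \<longlonglongrightarrow> F z"
    using bdd_hol_polynomial_approximation[OF F] by blast
  have F_bound: "bdd_hol F (D + 1)"
    using F by (force simp: bdd_hol_def)
  have "(\<lambda>n. cinner (mul (\<lambda>z. poly (p n) (B z)) I) (resolvent w J)) \<longlonglongrightarrow>
      cinner (mul (\<lambda>z. F (B z)) I) (resolvent w J)"
    by (rule tendsto_cinner_of_pointwise[OF norm_mul_le[OF bdd_hol_compose_B[OF p(1)]]
        tendsto_mul_compose_B[OF p(1) F_bound p(2)]])
  moreover have "(\<lambda>n. poly (p n) w * cinner I J) \<longlonglongrightarrow> F w * cinner I J"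
    by (intro tendsto_intros p(2) w)
  ultimately show ?thesis
    using mul_poly_wandering[OF w I J] by (simp add: LIMSEQ_unique)
qed

lemma wandering_combination_unique:
  fixes r :: nat
  assumes e: "orthonormal_on {..<r} e" "e ` {..<r} \<subseteq> wandering"
    and F: "\<forall>i<r. F i \<in> HinfB B" and zero: "\<And>z. (\<Sum>i<r. ev (e i) z * F i z) = 0"
    and i: "i < r"
  shows "F i z = 0"
proof -
  obtain G D where G: "\<And>i. i < r \<Longrightarrow> bdd_hol (G i) (D i)"
    "\<And>i. i < r \<Longrightarrow> F i = (\<lambda>z. if cmod z < 1 then G i (B z) else 0)"
    "(\<lambda>z. \<Sum>i<r. ev (e i) z * F i z) = ev (\<Sum>i<r. mul (\<lambda>z. G i (B z)) (e i))"
    by (rule HinfB_combination[OF F, where e = e]) (rule that)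
  have "ev (\<Sum>i<r. mul (\<lambda>z. G i (B z)) (e i)) = ev 0"
    unfolding G(3)[symmetric] by (simp add: zero fun_eq_iff)
  then have sum_0: "(\<Sum>i<r. mul (\<lambda>z. G i (B z)) (e i)) = 0"
    by (simp only: ev_inject)
  show ?thesis
  proof (cases "cmod z < 1")
    case True
    have coefficient: "cinner (mul (\<lambda>z. G j (B z)) (e j)) (resolvent (B z) (e i)) =
        (if j = i then G j (B z) else 0)" if "j < r" for j
      using cinner_mul_resolvent[OF G(1)[OF that] B_lt_1[OF True], of "e j" "e i"] that e(2) i
        orthonormal_onD[OF e(1), of j i]
      by (auto simp: image_subset_iff)
    have "0 = cinner (\<Sum>j<r. mul (\<lambda>z. G j (B z)) (e j)) (resolvent (B z) (e i))"
      by (simp add: sum_0 cinner.zero_left)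
    also have "\<dots> = (\<Sum>j<r. if j = i then G j (B z) else 0)"
      unfolding cinner.sum_left by (intro sum.cong) (simp_all add: coefficient)
    also have "\<dots> = G i (B z)"
      using i by simp
    finally show ?thesis
      by (simp add: G(2)[OF i])
  qed (simp add: G(2)[OF i])
qed

end

section \<open>Weak-star closed invariant subspaces\<close>

locale weakstar_invariant_subspace = inner_symbol +
  fixes M :: "(complex \<Rightarrow> complex) set"
  assumes M_subspace: "Hinf_subspace M" and M_closed: "weakstar_closed M"
    and M_invariant: "f \<in> M \<Longrightarrow> (\<lambda>z. B z * f z) \<in> M"
begin

lemma M_add: "f \<in> M \<Longrightarrow> g \<in> M \<Longrightarrow> (\<lambda>z. f z + g z) \<in> M"
  and M_scale: "f \<in> M \<Longrightarrow> (\<lambda>z. c * f z) \<in> M" and M_zero: "(\<lambda>z. 0) \<in> M"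
  using M_subspace by (auto simp: Hinf_subspace_def)

lemma M_subset_Hinf: "M \<subseteq> Hinf"
  using M_subspace by (simp add: Hinf_subspace_def)

lemma csubspace_ev_vimage: "csubspace (ev -` M)"
proof -
  have "ev 0 = (\<lambda>z. 0)" "ev (a + b) = (\<lambda>z. ev a z + ev b z)"
    "ev (c *\<^sub>C a) = (\<lambda>z. c * ev a z)" for a b c
    by (simp_all add: fun_eq_iff)
  then show ?thesis
    by (intro complex_vector.subspaceI) (simp_all add: M_zero M_add M_scale)
qed

lemma mul_B_mem: "a \<in> ev -` M \<Longrightarrow> mul B a \<in> ev -` M"
  using M_invariant[of "ev a"] by (simp add: ev_mul[OF bdd_hol_B])

lemma mul_compose_mem:
  assumes F: "bdd_hol F D" and a: "a \<in> ev -` M"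
  shows "mul (\<lambda>z. F (B z)) a \<in> ev -` M"
proof -
  obtain p where p: "\<And>n. bdd_hol (poly (p n)) (D + 1)"
    "\<And>z. cmod z < 1 \<Longrightarrow> (\<lambda>n. poly (p n) z) \<longlonglongrightarrow> F z"
    using bdd_hol_polynomial_approximation[OF F] by blast
  obtain E where E: "bdd_hol (ev a) E"
    using a M_subset_Hinf ev_mem_Hinf_iff by blast
  have F_bound: "bdd_hol F (D + 1)"
    using F by (force simp: bdd_hol_def)
  have poly: "mul (\<lambda>z. poly q (B z)) a \<in> ev -` M" for q
  proof (induction q)
    case 0
    show ?case
      unfolding mul_poly_B by (rule complex_vector.subspace_0[OF csubspace_ev_vimage])
  next
    case (pCons c q)
    then show ?case
      unfolding mul_poly_B
      by (intro complex_vector.subspace_add complex_vector.subspace_scale csubspace_ev_vimage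
          mul_B_mem a)
  qed
  have "ev (mul (\<lambda>z. F (B z)) a) \<in> M"
  proof (rule weakstar_closed_pointwise_limit[OF M_closed])
    show "ev (mul (\<lambda>z. poly (p n) (B z)) a) \<in> M" for n
      using poly by simp
    show "bdd_hol (ev (mul (\<lambda>z. poly (p n) (B z)) a)) ((D + 1) * E)" for n
      unfolding ev_mul[OF bdd_hol_compose_B[OF p(1)]] by (intro bdd_hol_mult bdd_hol_compose_B p E)
  qed (rule tendsto_mul_compose_B[OF p(1) F_bound p(2)])
  then show ?thesis by simp
qed

definition K :: "h2 set" where
  "K = closure (ev -` M)"

lemma ev_mem_imp_mem_K: "ev a \<in> M \<Longrightarrow> a \<in> K"
  using closure_subset[of "ev -` M"] by (auto simp: K_def)

sublocale symbol_invariant_subspace B C K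
proof
  show "csubspace K" "closed K"
    by (simp_all add: K_def csubspace_closure csubspace_ev_vimage)
  have "mul B ` closure (ev -` M) \<subseteq> closure (mul B ` (ev -` M))"
    by (rule closure_bounded_linear_image_subset[OF T.bounded_linear_axioms])
  also have "\<dots> \<subseteq> closure (ev -` M)"
    using mul_B_mem by (intro closure_mono) blast
  finally show "mul B a \<in> K" if "a \<in> K" for a
    using that by (auto simp: K_def)
qed (rule mem_range_mul_B_pow_imp_0)

text \<open>Damping the approximants of \<open>a\<close> makes them uniformly bounded and keeps their pointwise limit.\<close>

lemma bounded_mem_K_imp_ev_mem:
  assumes "a \<in> K" and D: "bdd_hol (ev a) D"
  shows "ev a \<in> M"
proof -
  obtain s where s: "\<And>n. ev (s n) \<in> M" "s \<longlonglongrightarrow> a"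
    using \<open>a \<in> K\<close> by (auto simp: K_def closure_sequential)
  define h where "h n = s n - a" for n
  have h: "h \<longlonglongrightarrow> 0"
    unfolding h_def by (rule LIM_zero[OF s(2)])
  have ev_s: "ev (s n) z = ev a z + ev (h n) z" for n z
    by (simp add: h_def)
  have ev_damped: "ev (mul (\<lambda>z. damping (h n) (B z)) b) z = damping (h n) (B z) * ev b z" for n b z
    by (simp add: ev_mul[OF bdd_hol_compose_B[OF bdd_hol_damping]])
  show ?thesis
  proof (rule weakstar_closed_pointwise_limit[OF M_closed])
    show "ev (mul (\<lambda>z. damping (h n) (B z)) (s n)) \<in> M" for n
      using mul_compose_mem[OF bdd_hol_damping] s(1) by simp
    show "bdd_hol (ev (mul (\<lambda>z. damping (h n) (B z)) (s n))) (D + C)" for n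
      unfolding bdd_hol_ev
    proof (intro allI impI)
      fix z assume z: "cmod z < 1"
      have "cmod (damping (h n) (B z) * ev a z) \<le> 1 * D"
        by (rule bdd_hol_le[OF bdd_hol_mult[OF bdd_hol_compose_B[OF bdd_hol_damping] D] z])
      moreover have "cmod (damping (h n) (B z) * ev (h n) z) \<le> C"
        using bdd_hol_le[OF bdd_hol_damping_mul z, of "h n"] by (simp add: ev_damped)
      ultimately show "cmod (ev (mul (\<lambda>z. damping (h n) (B z)) (s n)) z) \<le> D + C"
        unfolding ev_damped ev_s distrib_left by (simp add: norm_triangle_mono)
    qed
    show "(\<lambda>n. ev (mul (\<lambda>z. damping (h n) (B z)) (s n)) z) \<longlonglongrightarrow> ev a z" if "cmod z < 1" for z
    proof -
      have "(\<lambda>n. damping (h n) (B z) * ev (s n) z) \<longlonglongrightarrow> 1 * ev a z"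
        by (intro tendsto_intros tendsto_damping h s B_lt_1 that)
      then show ?thesis by (simp add: ev_damped)
    qed
  qed
qed

lemma mem_M_imp_wandering_combination:
  assumes e: "orthonormal_basis wandering r e" and "f \<in> M"
  obtains F where "\<forall>i<r. F i \<in> HinfB B" "f = (\<lambda>z. \<Sum>i<r. ev (e i) z * F i z)"
proof -
  have "norm (e i) = 1" "e i \<in> wandering" if "i < r" for i
    using e that norm_orthonormal[of "{..<r}" e i] by (auto simp: orthonormal_basis_def)
  moreover obtain a where a: "f = ev a"
    using \<open>f \<in> M\<close> M_subset_Hinf Hinf_subset_range_ev by blast
  moreover obtain D where "bdd_hol (ev a) D"
    using \<open>f \<in> M\<close> a M_subset_Hinf ev_mem_Hinf_iff by blast
  moreover have "a \<in> K"
    using \<open>f \<in> M\<close> a by (simp add: ev_mem_imp_mem_K)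
  ultimately have coefficient: "bdd_hol (\<lambda>w. cinner a (resolvent w (e i))) D" if "i < r" for i
    using that by (intro bdd_hol_cinner_resolvent)
  define F where "F i z = (if cmod z < 1 then cinner a (resolvent (B z) (e i)) else 0)" for i z
  have "F i \<in> HinfB B" if "i < r" for i
    using coefficient[OF that] unfolding HinfB_iff F_def[abs_def] by blast
  moreover have "f = (\<lambda>z. \<Sum>i<r. ev (e i) z * F i z)"
    unfolding a using ev_expansion[OF e \<open>a \<in> K\<close>] by (intro ev_eqI) (simp_all add: F_def)
  ultimately show ?thesis
    using that by blast
qed

lemma wandering_combination_mem_M:
  fixes r :: nat
  assumes e: "orthonormal_on {..<r} e" "e ` {..<r} \<subseteq> wandering"
    and F: "\<forall>i<r. F i \<in> HinfB B"
  shows "(\<lambda>z. \<Sum>i<r. ev (e i) z * F i z) \<in> M"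
proof -
  obtain G D where G: "\<And>i. i < r \<Longrightarrow> bdd_hol (G i) (D i)"
    "\<And>i. i < r \<Longrightarrow> F i = (\<lambda>z. if cmod z < 1 then G i (B z) else 0)"
    "(\<lambda>z. \<Sum>i<r. ev (e i) z * F i z) = ev (\<Sum>i<r. mul (\<lambda>z. G i (B z)) (e i))"
    by (rule HinfB_combination[OF F, where e = e]) (rule that)
  have "mul (\<lambda>z. G i (B z)) (e i) \<in> ev -` M" if "i < r" for i
  proof (rule mul_compose_mem[OF G(1)[OF that]])
    have "e i \<in> K"
      using e(2) that wandering_mem by blast
    then show "e i \<in> ev -` M"
      using bounded_mem_K_imp_ev_mem[OF _ bdd_hol_wandering[OF e]] that by simp
  qed
  then have "(\<Sum>i<r. mul (\<lambda>z. G i (B z)) (e i)) \<in> ev -` M"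
    by (intro complex_vector.subspace_sum[OF csubspace_ev_vimage]) simp
  then show ?thesis
    by (simp add: G(3))
qed

lemma M_eq_wandering_combinations:
  assumes e: "orthonormal_basis wandering r e"
  shows "M = {(\<lambda>z. \<Sum>i<r. ev (e i) z * F i z) | F. \<forall>i<r. F i \<in> HinfB B}"
proof (intro equalityI subsetI)
  fix f assume "f \<in> M"
  then show "f \<in> {(\<lambda>z. \<Sum>i<r. ev (e i) z * F i z) | F. \<forall>i<r. F i \<in> HinfB B}"
    using mem_M_imp_wandering_combination[OF e] by blast
next
  fix f assume "f \<in> {(\<lambda>z. \<Sum>i<r. ev (e i) z * F i z) | F. \<forall>i<r. F i \<in> HinfB B}"
  then show "f \<in> M"
    using e by (auto simp: orthonormal_basis_def intro!: wandering_combination_mem_M)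
qed

end

section \<open>Finite Blaschke products\<close>

definition normalized_szego :: "complex \<Rightarrow> h2" where
  "normalized_szego w = of_real (sqrt (1 - (cmod w)\<^sup>2)) *\<^sub>C szego w"

lemma norm_normalized_szego:
  assumes "cmod w < 1" shows "norm (normalized_szego w) = 1"
proof -
  have "1 - (cmod w)\<^sup>2 > 0"
    using assms by (simp add: abs_square_less_1)
  then have "(norm (normalized_szego w))\<^sup>2 = 1"
    using norm_szego_sq[OF assms] by (simp add: normalized_szego_def power_mult_distrib)
  then show ?thesis by (simp add: abs_square_eq_1)
qed

lemma cmod_ev_normalized_szego_sq:
  assumes "cmod w < 1" "cmod z < 1"
  shows "(cmod (ev (normalized_szego w) z))\<^sup>2 = (1 - (cmod w)\<^sup>2) / (cmod (1 - cnj w * z))\<^sup>2"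
  using assms
  by (simp add: normalized_szego_def ev_szego norm_mult norm_divide power_mult_distrib power_divide
      abs_square_le_1)

lemma moebius_defect:
  assumes w: "cmod w < 1" and z: "cmod z < 1"
  shows "1 - (cmod ((z - w) / (1 - cnj w * z)))\<^sup>2 =
    (1 - (cmod z)\<^sup>2) * (cmod (ev (normalized_szego w) z))\<^sup>2"
proof -
  have "1 - cnj w * z \<noteq> 0"
    by (rule one_minus_cnj_mult_nonzero[OF w z])
  moreover have "(cmod (1 - cnj w * z))\<^sup>2 - (cmod (z - w))\<^sup>2 = (1 - (cmod z)\<^sup>2) * (1 - (cmod w)\<^sup>2)"
    unfolding cmod_power2 by (simp add: power2_eq_square algebra_simps)
  ultimately show ?thesis
    unfolding cmod_ev_normalized_szego_sq[OF w z]
    by (simp add: norm_divide power_divide field_simps)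
qed

lemma moebius_less_1:
  assumes "cmod w < 1" "cmod z < 1" shows "cmod ((z - w) / (1 - cnj w * z)) < 1"
proof -
  have "(1 - (cmod z)\<^sup>2) * (cmod (ev (normalized_szego w) z))\<^sup>2 > 0"
    using assms one_minus_cnj_mult_nonzero[OF assms]
    by (auto simp: cmod_ev_normalized_szego_sq abs_square_less_1
        intro!: mult_pos_pos divide_pos_pos)
  then have "(cmod ((z - w) / (1 - cnj w * z)))\<^sup>2 < 1"
    unfolding moebius_defect[OF assms, symmetric] by simp
  then show ?thesis by (simp only: abs_square_less_1 abs_norm_cancel)
qed

lemma cmod_ev_normalized_szego_sq_le:
  assumes "cmod w < 1" "cmod z < 1"
  shows "(cmod (ev (normalized_szego w) z))\<^sup>2 \<le> (1 - (cmod w)\<^sup>2) / (1 - cmod w)\<^sup>2"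
proof -
  have "cmod (cnj w * z) \<le> cmod w * 1"
    unfolding norm_mult using assms by (intro mult_mono) auto
  then have "1 - cmod w \<le> cmod (1 - cnj w * z)"
    using norm_triangle_ineq2[of 1 "cnj w * z"] by simp
  then show ?thesis
    unfolding cmod_ev_normalized_szego_sq[OF assms] using assms
    by (intro divide_left_mono power_mono mult_pos_pos)
       (auto simp: abs_square_le_1 one_minus_cnj_mult_nonzero)
qed

lemma one_minus_prod_le:
  fixes x :: "'a \<Rightarrow> real"
  assumes "\<And>i. i \<in> A \<Longrightarrow> 0 \<le> x i \<and> x i \<le> 1"
  shows "1 - prod x A \<le> (\<Sum>i\<in>A. 1 - x i)"
  using assms
proof (induction A rule: infinite_finite_induct)
  case (insert i A)
  have "prod x A \<le> 1"
    using insert by (intro prod_le_1) auto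
  then have "x i + prod x A - 1 \<le> x i * prod x A"
    using insert(4)[of i] mult_nonneg_nonneg[of "1 - x i" "1 - prod x A"]
    by (simp add: algebra_simps)
  then show ?case
    using insert by simp
qed auto

context
  fixes a :: "complex list"
  assumes zeros: "\<forall>i<length a. a ! i \<in> ball 0 1"
begin

lemma blaschke_defect:
  assumes z: "cmod z < 1"
  shows "1 - (cmod (blaschke a z))\<^sup>2 \<le>
    (1 - (cmod z)\<^sup>2) * (\<Sum>i<length a. (cmod (ev (normalized_szego (a ! i)) z))\<^sup>2)"
proof -
  define x where "x i = (cmod ((z - a ! i) / (1 - cnj (a ! i) * z)))\<^sup>2" for i
  have "x i \<le> 1" if "i < length a" for i
    using moebius_less_1[of "a ! i" z] zeros that z by (simp add: x_def abs_square_le_1 less_imp_le)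
  then have "1 - (\<Prod>i<length a. x i) \<le> (\<Sum>i<length a. 1 - x i)"
    by (intro one_minus_prod_le) (simp add: x_def)
  also have "\<dots> = (1 - (cmod z)\<^sup>2) * (\<Sum>i<length a. (cmod (ev (normalized_szego (a ! i)) z))\<^sup>2)"
    unfolding sum_distrib_left x_def using zeros z by (intro sum.cong) (auto simp: moebius_defect)
  finally show ?thesis
    by (simp add: blaschke_def x_def prod_power_distrib flip: prod_norm)
qed

lemma blaschke_less_1:
  assumes "a \<noteq> []" "cmod z < 1" shows "cmod (blaschke a z) < 1"
proof -
  have "(\<Prod>i<length a. cmod ((z - a ! i) / (1 - cnj (a ! i) * z))) < (\<Prod>i<length a. 1)"
    using zeros assms by (intro prod_mono_strict[of 0]) (auto intro!: moebius_less_1 less_imp_le)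
  then show ?thesis
    by (simp add: blaschke_def flip: prod_norm)
qed

lemma blaschke_holomorphic: "blaschke a holomorphic_on ball 0 1"
proof -
  have "1 - cnj (a ! i) * z \<noteq> 0" if "i < length a" "cmod z < 1" for i z
    using one_minus_cnj_mult_nonzero[of "a ! i" z] zeros that by simp
  then show ?thesis
    unfolding blaschke_def[abs_def] by (intro holomorphic_intros) auto
qed

lemma blaschke_inner_symbol:
  assumes "a \<noteq> []" "a ! 0 = 0" obtains C where "inner_symbol (blaschke a) C"
proof
  define C where "C = (\<Sum>i<length a. (1 - (cmod (a ! i))\<^sup>2) / (1 - cmod (a ! i))\<^sup>2)"
  show "inner_symbol (blaschke a) C"
  proof
    show "blaschke a 0 = 0"
      using assms by (auto simp: blaschke_def intro!: bexI[of _ 0])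
    fix z assume z: "cmod z < 1"
    have "(\<Sum>i<length a. (cmod (ev (normalized_szego (a ! i)) z))\<^sup>2) \<le> C"
      unfolding C_def using zeros z by (intro sum_mono cmod_ev_normalized_szego_sq_le) auto
    then have "(1 - (cmod z)\<^sup>2) * (\<Sum>i<length a. (cmod (ev (normalized_szego (a ! i)) z))\<^sup>2)
        \<le> (1 - (cmod z)\<^sup>2) * C"
      using z by (intro mult_left_mono) (auto simp: abs_square_le_1)
    with blaschke_defect[OF z] show "1 - (cmod (blaschke a z))\<^sup>2 \<le> C * (1 - (cmod z)\<^sup>2)"
      by (simp add: mult.commute)
  qed (use assms blaschke_less_1 blaschke_holomorphic in auto)
qed

end

theorem theorem3p4:
  fixes a :: "complex list" and M :: "(complex \<Rightarrow> complex) set"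
  assumes zeros: "\<forall>i<length a. a ! i \<in> ball 0 1"
    and first0: "a \<noteq> []" "a ! 0 = 0"
    and subsp: "Hinf_subspace M"
    and wclosed: "weakstar_closed M"
    and inv: "\<forall>f\<in>M. (\<lambda>z. blaschke a z * f z) \<in> M"
  shows "\<exists>r J. r \<le> length a \<and> (\<forall>i<r. B_inner (blaschke a) (J i)) \<and>
           M = {(\<lambda>z. \<Sum>i<r. J i z * F i z) | F. \<forall>i<r. F i \<in> HinfB (blaschke a)} \<and>
           (\<forall>F. (\<forall>i<r. F i \<in> HinfB (blaschke a)) \<and> (\<forall>z. (\<Sum>i<r. J i z * F i z) = 0)
                 \<longrightarrow> (\<forall>i<r. \<forall>z. J i z * F i z = 0))"
proof -
  obtain C where "inner_symbol (blaschke a) C"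
    using blaschke_inner_symbol[OF zeros first0] .
  then interpret inner_symbol "blaschke a" C .
  interpret weakstar_invariant_subspace "blaschke a" C M
    by unfold_locales (use subsp wclosed inv in auto)
  have "r \<le> length a" if "orthonormal_on {..<r} e" "e ` {..<r} \<subseteq> wandering" for r e
    by (rule card_orthonormal_wandering_le[OF that blaschke_defect[OF zeros]])
       (use zeros in \<open>auto simp: norm_normalized_szego\<close>)
  then obtain r e where "r \<le> length a" and e: "orthonormal_basis wandering r e"
    using orthonormal_basis_exists[OF csubspace_wandering] by blast
  then have orthonormal: "orthonormal_on {..<r} e" "e ` {..<r} \<subseteq> wandering"
    by (auto simp: orthonormal_basis_def)
  show ?thesis
  proof (intro exI[of _ r] exI[of _ "\<lambda>i. ev (e i)"] conjI allI impI)
    show "M = {(\<lambda>z. \<Sum>i<r. ev (e i) z * F i z) | F. \<forall>i<r. F i \<in> HinfB (blaschke a)}"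
      by (rule M_eq_wandering_combinations[OF e])
    show "B_inner (blaschke a) (ev (e i))" if "i < r" for i
      using B_inner_wandering[OF orthonormal] that by simp
    show "ev (e i) z * F i z = 0" if "(\<forall>i<r. F i \<in> HinfB (blaschke a)) \<and>
        (\<forall>z. (\<Sum>i<r. ev (e i) z * F i z) = 0)" "i < r" for F i z
      using wandering_combination_unique[OF orthonormal] that by simp
  qed fact
qed

end
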